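(* Let $\Omega=(0,1)^2$ and let $w=w(x_1,x_2)\in H^2(\Omega)\cap H^1_0(\Omega)$. Then for every $\Gamma>0$, $$\|w\|_{C^0(\bar\Omega)}^2\le\frac12(1+\Gamma)\left[\|w_{x_1}\|^2_{L^2(\Omega)}+\|w_{x_2}\|^2_{L^2(\Omega)}\right]+\frac1\Gamma\|w_{x_1x_2}\|^2_{L^2(\Omega)}.$$
   Context: $w$ is real-valued; $\|w\|_{C^0(\bar\Omega)}=\max_{x\in\bar\Omega}|w(x)|$ (for the continuous representative); subscripts denote partial derivatives. *)

theory Defs
  imports "HOL-Analysis.Analysis"
begin

text \<open>
  Elements of Lebesgue and Sobolev spaces are represented by real-valued functions; functions that
  agree almost everywhere on \<open>\<Omega>\<close> represent the same element. Values outside \<open>\<Omega>\<close> are irrelevant.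
  The domain \<open>\<Omega>\<close> is meant to be an open set.
\<close>

subsection \<open>Test functions\<close>

definition partial :: "'a::euclidean_space \<Rightarrow> ('a \<Rightarrow> real) \<Rightarrow> 'a \<Rightarrow> real" where
  "partial i f x = frechet_derivative f (at x) i"

text \<open>A list of basis vectors plays the role of a multi-index, its length that of the order.\<close>

primrec partials :: "'a::euclidean_space list \<Rightarrow> ('a \<Rightarrow> real) \<Rightarrow> 'a \<Rightarrow> real" where
  "partials [] f = f"
| "partials (i # \<alpha>) f = partial i (partials \<alpha> f)"

text \<open>
  All iterated partial derivatives are (totally) differentiable, hence in particular continuous;
  this is the usual class of infinitely differentiable functions.
\<close>

definition smooth :: "('a::euclidean_space \<Rightarrow> real) \<Rightarrow> bool" where
  "smooth f \<longleftrightarrow> (\<forall>\<alpha>. set \<alpha> \<subseteq> Basis \<longrightarrow> (\<forall>x. partials \<alpha> f differentiable (at x)))"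

text \<open>Smooth functions with compact support in \<open>\<Omega>\<close>, extended by zero to the whole space.\<close>

definition test_functions :: "'a::euclidean_space set \<Rightarrow> ('a \<Rightarrow> real) set" where
  "test_functions \<Omega> = {\<phi>. smooth \<phi> \<and> (\<exists>K. compact K \<and> K \<subseteq> \<Omega> \<and> (\<forall>x. x \<notin> K \<longrightarrow> \<phi> x = 0))}"

subsection \<open>Square-integrable functions and weak derivatives\<close>

definition L2_space :: "'a::euclidean_space set \<Rightarrow> ('a \<Rightarrow> real) set" where
  "L2_space \<Omega> = {f. f \<in> borel_measurable (lebesgue_on \<Omega>) \<and>
                    integrable (lebesgue_on \<Omega>) (\<lambda>x. (f x)\<^sup>2)}"

definition L2_norm :: "'a::euclidean_space set \<Rightarrow> ('a \<Rightarrow> real) \<Rightarrow> real" where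
  "L2_norm \<Omega> f = sqrt (\<integral>x. (f x)\<^sup>2 \<partial>lebesgue_on \<Omega>)"

definition locally_integrable :: "'a::euclidean_space set \<Rightarrow> ('a \<Rightarrow> real) \<Rightarrow> bool" where
  "locally_integrable \<Omega> f \<longleftrightarrow> (\<forall>K. compact K \<and> K \<subseteq> \<Omega> \<longrightarrow> integrable (lebesgue_on K) f)"

definition has_weak_deriv ::
  "'a::euclidean_space set \<Rightarrow> 'a list \<Rightarrow> ('a \<Rightarrow> real) \<Rightarrow> ('a \<Rightarrow> real) \<Rightarrow> bool" where
  "has_weak_deriv \<Omega> \<alpha> f g \<longleftrightarrow>
     locally_integrable \<Omega> f \<and> locally_integrable \<Omega> g \<and>
     (\<forall>\<phi>\<in>test_functions \<Omega>.
        (\<integral>x. f x * partials \<alpha> \<phi> x \<partial>lebesgue_on \<Omega>) =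
        (- 1) ^ length \<alpha> * (\<integral>x. g x * \<phi> x \<partial>lebesgue_on \<Omega>))"

text \<open>A representative of the weak derivative, which is unique up to null sets when it exists.\<close>

definition weak_deriv ::
  "'a::euclidean_space set \<Rightarrow> 'a list \<Rightarrow> ('a \<Rightarrow> real) \<Rightarrow> 'a \<Rightarrow> real" where
  "weak_deriv \<Omega> \<alpha> f = (SOME g. has_weak_deriv \<Omega> \<alpha> f g)"

subsection \<open>Sobolev spaces\<close>

text \<open>\<open>sobolev k \<Omega>\<close> is \<open>H\<^sup>k(\<Omega>)\<close>.\<close>

definition sobolev :: "nat \<Rightarrow> 'a::euclidean_space set \<Rightarrow> ('a \<Rightarrow> real) set" where
  "sobolev k \<Omega> = {f \<in> L2_space \<Omega>. \<forall>\<alpha>. set \<alpha> \<subseteq> Basis \<and> length \<alpha> \<le> k \<longrightarrow>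
                    (\<exists>g\<in>L2_space \<Omega>. has_weak_deriv \<Omega> \<alpha> f g)}"

definition H1_norm :: "'a::euclidean_space set \<Rightarrow> ('a \<Rightarrow> real) \<Rightarrow> real" where
  "H1_norm \<Omega> f =
     sqrt ((L2_norm \<Omega> f)\<^sup>2 + (\<Sum>i\<in>Basis. (L2_norm \<Omega> (weak_deriv \<Omega> [i] f))\<^sup>2))"

text \<open>\<open>H\<^sup>1\<^sub>0(\<Omega>)\<close>: the closure of the test functions in \<open>H\<^sup>1(\<Omega>)\<close>.\<close>

definition sobolev_H10 :: "'a::euclidean_space set \<Rightarrow> ('a \<Rightarrow> real) set" where
  "sobolev_H10 \<Omega> =
     {f \<in> sobolev 1 \<Omega>. \<forall>\<epsilon>>0. \<exists>\<phi>\<in>test_functions \<Omega>. H1_norm \<Omega> (\<lambda>x. f x - \<phi> x) < \<epsilon>}"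

subsection \<open>Continuous representatives\<close>

text \<open>For open \<open>\<Omega>\<close> such a function is uniquely determined on \<open>closure \<Omega>\<close>.\<close>

definition continuous_representative ::
  "'a::euclidean_space set \<Rightarrow> ('a \<Rightarrow> real) \<Rightarrow> ('a \<Rightarrow> real) \<Rightarrow> bool" where
  "continuous_representative \<Omega> f u \<longleftrightarrow>
     continuous_on (closure \<Omega>) u \<and> (AE x in lebesgue_on \<Omega>. u x = f x)"

text \<open>The supremum is a maximum when \<open>\<Omega>\<close> is bounded and nonempty and \<open>u\<close> is continuous.\<close>

definition C0_norm :: "'a::euclidean_space set \<Rightarrow> ('a \<Rightarrow> real) \<Rightarrow> real" where
  "C0_norm \<Omega> u = (SUP x\<in>closure \<Omega>. \<bar>u x\<bar>)"

subsection \<open>The unit square\<close>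

definition unit_square :: "(real \<times> real) set" where
  "unit_square = {0<..<1} \<times> {0<..<1}"

abbreviation e1 :: "real \<times> real" where "e1 \<equiv> (1, 0)"
abbreviation e2 :: "real \<times> real" where "e2 \<equiv> (0, 1)"

end

theory Submission
  imports Defs
begin

text \<open>
  Let \<open>w\<close> vanish on the boundary and let \<open>G\<close> be its mixed derivative \<open>w\<^bsub>x1 x2\<^esub>\<close>. For smooth \<open>w\<close>, integrating
  \<open>w\<^bsub>x1\<^esub>\<close> along a horizontal line from either end gives \<open>2 \<bar>w(x1, r)\<bar> \<le> \<integral> \<bar>w\<^bsub>x1\<^esub>(s, r)\<bar> ds\<close> for every
  height \<open>r\<close>. Changing the height from \<open>r\<close> to \<open>x2\<close> costs the integral of \<open>G\<close> over a rectangle between the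
  two heights, which again may be taken to the left or to the right of \<open>x1\<close>. Averaging over \<open>r\<close> in an
  interval \<open>J\<close> of length \<open>\<delta>\<close> that touches \<open>x2\<close> yields
  \<open>2 \<delta> \<bar>w(x1, x2)\<bar> \<le> \<integral>\<integral> (\<bar>w\<^bsub>x1\<^esub>\<bar> + \<delta> \<bar>G\<bar>)\<close> over the strip \<open>(0,1) \<times> J\<close>. By Cauchy-Schwarz
  \<open>w(x1, x2)\<^sup>2 \<le> (\<parallel>w\<^bsub>x1\<^esub>\<parallel>\<^sup>2 / \<delta> + \<delta> \<parallel>G\<parallel>\<^sup>2) / 2\<close>, and \<open>\<delta> = 1/(1+\<Gamma>)\<close> gives the claim
  (\<open>corner_integral_strip_bound\<close>, \<open>corner_integral_bound\<close>).

  For \<open>w\<close> in the Sobolev space neither traces nor sections of \<open>w\<close>, \<open>w\<^bsub>x1\<^esub>\<close> and \<open>G\<close> are used. The continuous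
  representative is the integral \<open>u(x) = \<integral>\<integral> G\<close> over \<open>(0,x1) \<times> (0,x2)\<close> (\<open>corner_integral\<close>), and every relation
  between \<open>w\<close>, \<open>w\<^bsub>x1\<^esub>\<close> and \<open>G\<close> is a statement about integrals over rectangles. These follow from
  integration by parts against products \<open>a(x1) b(x2)\<close> of smooth functions that need not vanish at the
  boundary. For a single derivative this is the density of test functions in \<open>H\<^sup>1\<^sub>0\<close> (\<open>H10_by_parts\<close>); for the mixed
  derivative the compact support is removed for one factor at a time by cut-off functions
  (\<open>mixed_by_parts\<close>). Letting the derivatives of \<open>a\<close> and \<open>b\<close> tend to indicators of intervals, one finds
  that \<open>u\<close> and \<open>w\<close> have equal integrals over rectangles, hence agree almost everywhere
  (\<open>corner_integral_eq\<close>), and that \<open>w\<^bsub>x1\<^esub>\<close> and \<open>G\<close> are related on strips as in the smooth case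
  (\<open>strip_identity\<close>, \<open>mixed_integral_over_strip\<close>).

  The representatives chosen by \<open>weak_deriv\<close> are square-integrable because weak derivatives are unique up
  to null sets (\<open>has_weak_deriv_unique\<close>). This needs sufficiently many test functions, which are
  constructed from \<open>exp (-1/x)\<close> (\<open>smooth_approx_indicator\<close>).
\<close>

section \<open>Smooth functions of one real variable\<close>

text \<open>
  The recursion on the order starts from the first derivative. In this form an antiderivative of a smooth
  function is smooth without further work, and closure under products is an induction on the order.
\<close>

primrec differentiable_times :: "nat \<Rightarrow> (real \<Rightarrow> real) \<Rightarrow> bool" where
  "differentiable_times 0 f \<longleftrightarrow> True"
| "differentiable_times (Suc k) f \<longleftrightarrow>
     (\<exists>f'. (\<forall>x. (f has_real_derivative f' x) (at x)) \<and> differentiable_times k f')"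

definition smooth1 :: "(real \<Rightarrow> real) \<Rightarrow> bool" where
  "smooth1 f \<longleftrightarrow> (\<forall>k. differentiable_times k f)"

lemma differentiable_times_antimono: "differentiable_times (Suc k) f \<Longrightarrow> differentiable_times k f"
  by (induction k arbitrary: f) auto

lemma differentiable_times_const: "differentiable_times k (\<lambda>x. c)"
  by (induction k arbitrary: c) (auto intro!: exI[of _ "\<lambda>x. 0"])

lemma differentiable_times_add:
  "differentiable_times k f \<Longrightarrow> differentiable_times k g \<Longrightarrow> differentiable_times k (\<lambda>x. f x + g x)"
proof (induction k arbitrary: f g)
  case (Suc k)
  then obtain f' g' where
    "\<And>x. (f has_real_derivative f' x) (at x)" "differentiable_times k f'"
    "\<And>x. (g has_real_derivative g' x) (at x)" "differentiable_times k g'"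
    by auto
  with Suc.IH[of f' g'] show ?case
    by (auto intro!: exI[of _ "\<lambda>x. f' x + g' x"] derivative_intros)
qed simp

lemma differentiable_times_mult:
  "differentiable_times k f \<Longrightarrow> differentiable_times k g \<Longrightarrow> differentiable_times k (\<lambda>x. f x * g x)"
proof (induction k arbitrary: f g)
  case (Suc k)
  then obtain f' g' where D:
    "\<And>x. (f has_real_derivative f' x) (at x)" "differentiable_times k f'"
    "\<And>x. (g has_real_derivative g' x) (at x)" "differentiable_times k g'"
    by auto
  have "differentiable_times k f" "differentiable_times k g"
    using Suc.prems differentiable_times_antimono by blast+
  then have "differentiable_times k (\<lambda>x. f' x * g x + g' x * f x)"
    by (intro differentiable_times_add Suc.IH D)
  moreover have "((\<lambda>x. f x * g x) has_real_derivative f' x * g x + g' x * f x) (at x)" for x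
    using DERIV_mult[OF D(1) D(3)] by simp
  ultimately show ?case
    by (auto intro!: exI[of _ "\<lambda>x. f' x * g x + g' x * f x"])
qed simp

lemma differentiable_times_affine:
  "differentiable_times k f \<Longrightarrow> differentiable_times k (\<lambda>x. f (c * x + d))"
proof (induction k arbitrary: f)
  case (Suc k)
  then obtain f' where D: "\<And>x. (f has_real_derivative f' x) (at x)" "differentiable_times k f'"
    by auto
  have "((\<lambda>x. f (c * x + d)) has_real_derivative f' (c * x + d) * c) (at x)" for x
    by (rule DERIV_chain2[OF D(1)]) (auto intro!: derivative_eq_intros)
  moreover have "differentiable_times k (\<lambda>x. f' (c * x + d) * c)"
    by (rule differentiable_times_mult[OF Suc.IH[OF D(2)] differentiable_times_const])
  ultimately show ?case
    by (auto intro!: exI[of _ "\<lambda>x. f' (c * x + d) * c"])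
qed simp

lemma smooth1_const: "smooth1 (\<lambda>x. c)"
  and smooth1_add: "smooth1 f \<Longrightarrow> smooth1 g \<Longrightarrow> smooth1 (\<lambda>x. f x + g x)"
  and smooth1_mult: "smooth1 f \<Longrightarrow> smooth1 g \<Longrightarrow> smooth1 (\<lambda>x. f x * g x)"
  and smooth1_affine: "smooth1 f \<Longrightarrow> smooth1 (\<lambda>x. f (c * x + d))"
  by (auto simp: smooth1_def differentiable_times_const differentiable_times_add
      differentiable_times_mult differentiable_times_affine)

text \<open>
  One more derivative on top of all those of \<open>f'\<close>: this is what allows smooth functions to be
  built by integration.
\<close>

lemma smooth1_antiderivative:
  assumes "\<And>x. (f has_real_derivative f' x) (at x)" "smooth1 f'"
  shows "smooth1 f"
  unfolding smooth1_def
proof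
  show "differentiable_times k f" for k
    using assms by (cases k) (auto simp: smooth1_def)
qed

lemma smooth1_has_derivative:
  assumes "smooth1 f" shows "(f has_real_derivative deriv f x) (at x)"
proof -
  have "differentiable_times (Suc 0) f"
    using assms by (simp only: smooth1_def)
  then show ?thesis
    by (auto simp: DERIV_deriv_iff_real_differentiable real_differentiable_def)
qed

lemma smooth1_deriv:
  assumes "smooth1 f" shows "smooth1 (deriv f)"
  unfolding smooth1_def
proof
  fix k
  obtain f' where f': "\<And>x. (f has_real_derivative f' x) (at x)" "differentiable_times k f'"
    using assms[unfolded smooth1_def, rule_format, of "Suc k"] by auto
  then have "deriv f = f'"
    by (auto intro!: DERIV_imp_deriv)
  with f' show "differentiable_times k (deriv f)"
    by simp
qed

lemma smooth1_continuous: "smooth1 f \<Longrightarrow> continuous_on S f"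
  by (meson DERIV_isCont continuous_at_imp_continuous_on smooth1_has_derivative)

lemma smooth1_measurable: "smooth1 f \<Longrightarrow> f \<in> borel_measurable borel"
  using smooth1_continuous[of f UNIV] by (rule borel_measurable_continuous_onI)

lemma smooth1_has_antiderivative:
  assumes "smooth1 f"
  obtains F where "smooth1 F" "deriv F = f"
proof -
  have "\<exists>F. \<forall>x::real. (- \<infinity>::ereal) < x \<longrightarrow> x < (\<infinity>::ereal) \<longrightarrow>
          (F has_vector_derivative f x) (at x)"
    using assms smooth1_continuous[OF assms, of UNIV]
    by (intro einterval_antiderivative) (auto simp: continuous_on_eq_continuous_at)
  then obtain F where F: "\<And>x. (F has_real_derivative f x) (at x)"
    by (auto simp: has_real_derivative_iff_has_vector_derivative)
  show thesis
    using smooth1_antiderivative[OF F assms] F that[of F] by (auto intro!: DERIV_imp_deriv)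
qed

text \<open>
  The extra power of \<open>x\<close> in the denominator makes the family closed under differentiation up to
  linear combinations, so a single induction shows that all members are smooth.
\<close>

definition flat_exp :: "nat \<Rightarrow> real \<Rightarrow> real" where
  "flat_exp k x = (if x > 0 then exp (- 1 / x) / x ^ k else 0)"

lemma flat_exp_tendsto_0: "((\<lambda>x. flat_exp k x) \<longlongrightarrow> 0) (at_right 0)"
proof -
  have "((\<lambda>y::real. y ^ k / exp y) \<longlongrightarrow> 0) at_top"
    by (rule tendsto_power_div_exp_0)
  then have "((\<lambda>x::real. inverse x ^ k / exp (inverse x)) \<longlongrightarrow> 0) (at_right 0)"
    by (rule filterlim_compose) (rule filterlim_inverse_at_top_right)
  moreover have "eventually (\<lambda>x::real. inverse x ^ k / exp (inverse x) = flat_exp k x) (at_right 0)"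
    by (auto simp: eventually_at_filter flat_exp_def exp_minus field_simps)
  ultimately show ?thesis
    by (rule Lim_transform_eventually)
qed

text \<open>
  Away from zero this is calculus. At zero the difference quotient is the function with the next
  exponent, which tends to zero because the exponential beats every power.
\<close>

lemma flat_exp_has_derivative:
  "(flat_exp k has_real_derivative flat_exp (k + 2) x - k * flat_exp (k + 1) x) (at x)"
proof -
  consider "x > 0" | "x < 0" | "x = 0" by linarith
  then show ?thesis
  proof cases
    case 1
    have "x * x ^ (n - Suc 0) = x ^ n" if "n \<noteq> 0" for n
      using that by (cases n) auto
    then have "((\<lambda>x. exp (- 1 / x) / x ^ k) has_real_derivative
            flat_exp (k + 2) x - k * flat_exp (k + 1) x) (at x)"
      using 1 by (cases k) (auto intro!: derivative_eq_intros simp: flat_exp_def field_simps power2_eq_square, metis neq0_conv)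
    then show ?thesis
      by (rule has_field_derivative_transform_within_open[where S = "{0<..}"])
         (use 1 in \<open>auto simp: flat_exp_def\<close>)
  next
    case 2
    have "((\<lambda>x. 0) has_real_derivative flat_exp (k + 2) x - k * flat_exp (k + 1) x) (at x)"
      using 2 by (auto simp: flat_exp_def)
    then show ?thesis
      by (rule has_field_derivative_transform_within_open[where S = "{..<0}"])
         (use 2 in \<open>auto simp: flat_exp_def\<close>)
  next
    case 3
    have "((\<lambda>h. flat_exp k h / h) \<longlongrightarrow> 0) (at 0)"
    proof (rule filterlim_split_at)
      show "((\<lambda>h. flat_exp k h / h) \<longlongrightarrow> 0) (at_left 0)"
        by (rule tendsto_eventually) (auto simp: eventually_at_filter flat_exp_def)
      show "((\<lambda>h. flat_exp k h / h) \<longlongrightarrow> 0) (at_right 0)"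
        by (rule Lim_transform_eventually[OF flat_exp_tendsto_0[of "Suc k"]])
           (auto simp: eventually_at_filter flat_exp_def field_simps)
    qed
    then show ?thesis
      using 3 by (simp add: DERIV_def flat_exp_def)
  qed
qed

lemma smooth1_flat_exp: "smooth1 (flat_exp k)"
proof -
  have "differentiable_times n (flat_exp k)" for n
  proof (induction n arbitrary: k)
    case (Suc n)
    have "differentiable_times n (\<lambda>x. flat_exp (k + 2) x + (- real k) * flat_exp (k + 1) x)"
      by (intro differentiable_times_add differentiable_times_mult differentiable_times_const Suc)
    with flat_exp_has_derivative[of k] show ?case
      by (auto intro!: exI[of _ "\<lambda>x. flat_exp (k + 2) x - real k * flat_exp (k + 1) x"])
  qed simp
  then show ?thesis
    by (simp add: smooth1_def)
qed

text \<open>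
  The normalised antiderivative of the bump \<open>exp (-1/x) exp (-1/(1-x))\<close> on the unit interval; a
  quotient of flat functions would need smoothness of quotients.
\<close>

lemma smooth_step:
  obtains s where "smooth1 s" "\<And>x. x \<le> 0 \<Longrightarrow> s x = 0" "\<And>x. x \<ge> 1 \<Longrightarrow> s x = 1"
    "\<And>x. 0 \<le> s x" "\<And>x. s x \<le> 1"
proof -
  define r where "r x = flat_exp 0 x * flat_exp 0 ((- 1) * x + 1)" for x
  have "smooth1 r"
    unfolding r_def by (rule smooth1_mult[OF smooth1_flat_exp smooth1_affine[OF smooth1_flat_exp]])
  then obtain F where F: "smooth1 F" "deriv F = r"
    by (rule smooth1_has_antiderivative)
  have DF: "(F has_real_derivative r x) (at x)" for x
    using smooth1_has_derivative[OF F(1)] F(2) by simp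
  have r0: "r x \<ge> 0" for x
    by (auto simp: r_def flat_exp_def)
  have mono: "F x \<le> F y" if "x \<le> y" for x y
    using that DF r0 by (meson DERIV_nonneg_imp_nondecreasing)
  have left: "F x = F 0" if x0: "x \<le> 0" for x
  proof (cases "x = 0")
    case False
    then obtain z where "x < z" "z < 0" "F 0 - F x = (0 - x) * r z"
      using x0 DF MVT2[of x 0 F r] by auto
    then show ?thesis by (auto simp: r_def flat_exp_def)
  qed simp
  have right: "F x = F 1" if x1: "x \<ge> 1" for x
  proof (cases "x = 1")
    case False
    then obtain z where "1 < z" "z < x" "F x - F 1 = (x - 1) * r z"
      using x1 DF MVT2[of 1 x F r] by auto
    then show ?thesis by (auto simp: r_def flat_exp_def)
  qed simp
  obtain z where "0 < z" "z < 1" "F 1 - F 0 = r z"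
    using DF MVT2[of 0 1 F r] by auto
  moreover from this have "r z > 0"
    by (simp add: r_def flat_exp_def)
  ultimately have pos: "F 0 < F 1"
    by simp
  define s where "s x = (F x + (- F 0)) * (1 / (F 1 - F 0))" for x
  show thesis
  proof (rule that[of s])
    show "smooth1 s"
      unfolding s_def by (intro smooth1_mult smooth1_add smooth1_const F)
    show "s x = 0" if "x \<le> 0" for x
      using left[OF that] by (simp add: s_def)
    show "s x = 1" if "x \<ge> 1" for x
      using right[OF that] pos by (simp add: s_def)
    show "0 \<le> s x" for x
      using mono[of 0 x] left[of x] pos by (cases "x \<le> 0") (auto simp: s_def)
    show "s x \<le> 1" for x
      using mono[of x 1] right[of x] pos by (cases "x \<le> 1") (auto simp: s_def)
  qed
qed

definition supported_in :: "real \<Rightarrow> real \<Rightarrow> (real \<Rightarrow> real) \<Rightarrow> bool" where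
  "supported_in p q f \<longleftrightarrow> (\<exists>p' q'. p < p' \<and> q' < q \<and> (\<forall>x. x \<notin> {p'..q'} \<longrightarrow> f x = 0))"

text \<open>
  Rescaled smooth steps, rising just after \<open>p\<close> and falling just before \<open>q\<close>. All passages from smooth
  to indicator functions rest on this sequence together with dominated convergence. For \<open>p \<ge> q\<close> the
  functions vanish, so no case distinction is needed later.
\<close>

lemma smooth_approx_indicator:
  fixes p q :: real
  obtains \<eta> :: "nat \<Rightarrow> real \<Rightarrow> real" where "\<And>n. smooth1 (\<eta> n)" "\<And>n. supported_in p q (\<eta> n)"
    "\<And>n x. 0 \<le> \<eta> n x" "\<And>n x. \<eta> n x \<le> 1"
    "\<And>x. (\<lambda>n. \<eta> n x) \<longlonglongrightarrow> indicator {p<..<q} x"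
proof -
  obtain s where s: "smooth1 s" "\<And>x. x \<le> 0 \<Longrightarrow> s x = 0" "\<And>x. x \<ge> 1 \<Longrightarrow> s x = 1"
    "\<And>x. 0 \<le> s x" "\<And>x. s x \<le> 1"
    using smooth_step by blast
  define \<eta> where "\<eta> n x = s (real (Suc n) * x + (- real (Suc n) * p - 1))
      * s (- real (Suc n) * x + (real (Suc n) * q - 1))" for n x
  show thesis
  proof (rule that[of \<eta>])
    show "smooth1 (\<eta> n)" for n
      unfolding \<eta>_def by (rule smooth1_mult[OF smooth1_affine[OF s(1)] smooth1_affine[OF s(1)]])
    show "0 \<le> \<eta> n x" "\<eta> n x \<le> 1" for n x
      unfolding \<eta>_def using s by (auto intro!: mult_le_one)
    show "supported_in p q (\<eta> n)" for n
      unfolding supported_in_def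
    proof (intro exI conjI allI impI)
      show "p < p + 1 / Suc n" "q - 1 / Suc n < q"
        by (auto simp: divide_pos_pos)
      fix x assume "x \<notin> {p + 1 / Suc n..q - 1 / Suc n}"
      then have "x - p < 1 / Suc n \<or> q - x < 1 / Suc n"
        by auto
      then have "real (Suc n) * (x - p) < 1 \<or> real (Suc n) * (q - x) < 1"
        by (simp add: less_divide_eq mult.commute)
      then have "real (Suc n) * x + (- real (Suc n) * p - 1) \<le> 0
          \<or> - real (Suc n) * x + (real (Suc n) * q - 1) \<le> 0"
        by (auto simp: algebra_simps)
      then show "\<eta> n x = 0"
        using s(2) by (auto simp: \<eta>_def)
    qed
    show "(\<lambda>n. \<eta> n x) \<longlonglongrightarrow> indicator {p<..<q} x" for x
    proof (cases "p < x \<and> x < q")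
      case True
      then have "0 < x - p" "0 < q - x" by auto
      then obtain N M where N: "2 / (x - p) < real N" and M: "2 / (q - x) < real M"
        using reals_Archimedean2 by meson
      have "\<eta> n x = 1" if "n \<ge> max N M" for n
      proof -
        have "2 / (x - p) < Suc n" "2 / (q - x) < Suc n"
          using N M that by auto
        then have "2 \<le> real (Suc n) * (x - p)" "2 \<le> real (Suc n) * (q - x)"
          using True by (auto simp: divide_less_eq algebra_simps)
        then have "real (Suc n) * x + (- real (Suc n) * p - 1) \<ge> 1"
          "- real (Suc n) * x + (real (Suc n) * q - 1) \<ge> 1"
          by (auto simp: algebra_simps)
        then show ?thesis
          using s(3) by (simp add: \<eta>_def)
      qed
      then show ?thesis
        using True by (intro tendsto_eventually) (auto simp: eventually_sequentially intro!: exI[of _ "max N M"])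
    next
      case False
      have "\<eta> n x = 0" for n
      proof -
        have "real (Suc n) * (x - p) \<le> 0 \<or> real (Suc n) * (q - x) \<le> 0"
          using False by (auto simp: mult_nonneg_nonpos simp del: of_nat_Suc)
        then have "real (Suc n) * x + (- real (Suc n) * p - 1) \<le> 0
          \<or> - real (Suc n) * x + (real (Suc n) * q - 1) \<le> 0"
          by (auto simp: algebra_simps)
        then show ?thesis
          using s(2) by (auto simp: \<eta>_def)
      qed
      with False show ?thesis
        by (auto simp: indicator_def)
    qed
  qed
qed

section \<open>The unit square and tensor products\<close>

lemma Basis_plane: "(Basis :: (real \<times> real) set) = {e1, e2}"
  by (auto simp: Basis_prod_def)

lemma unit_square_eq_box: "unit_square = box (0, 0) (1, 1)"
  by (auto simp: unit_square_def box_prod)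

lemma unit_square_lmeasurable: "unit_square \<in> lmeasurable"
  by (simp add: unit_square_eq_box)

lemma unit_square_sets [simp]: "unit_square \<in> sets lebesgue"
  using unit_square_lmeasurable by blast

abbreviation square_measure :: "(real \<times> real) measure" where
  "square_measure \<equiv> lebesgue_on unit_square"

lemma space_square_measure [simp]: "space square_measure = unit_square"
  by simp

lemma measure_square: "measure square_measure unit_square = 1"
  by (simp add: measure_restrict_space unit_square_eq_box measure_lborel_box_eq Basis_plane)

interpretation square: finite_measure square_measure
  by (rule finite_measure_lebesgue_on[OF unit_square_lmeasurable])

lemma integrable_lebesgue_on_subset:
  fixes f :: "'a::euclidean_space \<Rightarrow> real"
  assumes "integrable (lebesgue_on S) f" "S \<in> sets lebesgue" "T \<in> sets lebesgue" "T \<subseteq> S"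
  shows "integrable (lebesgue_on T) f"
  using set_integrable_subset[of lebesgue S f T] assms
  by (simp add: set_integrable_def integrable_restrict_space)

lemma integrable_square_continuous:
  fixes f :: "real \<times> real \<Rightarrow> real"
  assumes "continuous_on UNIV f"
  shows "integrable square_measure f"
proof -
  have "integrable (lebesgue_on (cbox (0,0) (1,1))) f"
    by (intro continuous_imp_integrable continuous_on_subset[OF assms]) auto
  then show ?thesis
    by (rule integrable_lebesgue_on_subset) (auto simp: unit_square_eq_box box_subset_cbox)
qed

lemma measurable_square:
  "f \<in> borel_measurable borel \<Longrightarrow> f \<in> borel_measurable square_measure"
  by (intro measurable_restrict_space1 measurable_completion) simp

lemma L2_integrable:
  assumes "f \<in> L2_space unit_square"
  shows "integrable square_measure f"
proof (rule square.square_integrable_imp_integrable)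
  show "f \<in> borel_measurable square_measure" "integrable square_measure (\<lambda>x. (f x)\<^sup>2)"
    using assms unfolding L2_space_def by blast+
qed

lemma locally_integrable_square:
  "integrable square_measure f \<Longrightarrow> locally_integrable unit_square f"
  unfolding locally_integrable_def
  by (meson integrable_lebesgue_on_subset lmeasurable_compact fmeasurableD unit_square_sets)

text \<open>
  All test functions that the argument needs are products of this kind; their partial derivatives stay
  products, which reduces smoothness in the plane to smoothness on the line.
\<close>

definition tensor :: "(real \<Rightarrow> real) \<Rightarrow> (real \<Rightarrow> real) \<Rightarrow> real \<times> real \<Rightarrow> real" where
  "tensor a b x = a (fst x) * b (snd x)"

lemma tensor_has_derivative:
  assumes "smooth1 a" "smooth1 b"
  shows "(tensor a b has_derivative
    (\<lambda>h. fst h * (deriv a (fst x) * b (snd x)) + snd h * (a (fst x) * deriv b (snd x)))) (at x)"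
proof -
  have a: "(a has_derivative (\<lambda>h. deriv a (fst x) * h)) (at (fst x))"
    and b: "(b has_derivative (\<lambda>h. deriv b (snd x) * h)) (at (snd x))"
    using assms[THEN smooth1_has_derivative] by (simp_all add: has_field_derivative_def)
  have "((\<lambda>x. a (fst x)) has_derivative (\<lambda>h. deriv a (fst x) * fst h)) (at x)"
    by (rule has_derivative_compose[OF has_derivative_fst[OF has_derivative_ident] a])
  moreover have "((\<lambda>x. b (snd x)) has_derivative (\<lambda>h. deriv b (snd x) * snd h)) (at x)"
    by (rule has_derivative_compose[OF has_derivative_snd[OF has_derivative_ident] b])
  ultimately show ?thesis
    unfolding tensor_def
    by (rule has_derivative_eq_rhs[OF has_derivative_mult]) (auto simp: algebra_simps)
qed

lemma partial_tensor:
  assumes "smooth1 a" "smooth1 b"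
  shows "partial e1 (tensor a b) = tensor (deriv a) b"
    and "partial e2 (tensor a b) = tensor a (deriv b)"
  using frechet_derivative_at[OF tensor_has_derivative[OF assms], symmetric]
  by (auto simp: partial_def tensor_def fun_eq_iff)

lemma partials_tensor:
  assumes "smooth1 a" "smooth1 b" "set \<alpha> \<subseteq> Basis"
  shows "\<exists>a' b'. smooth1 a' \<and> smooth1 b' \<and> partials \<alpha> (tensor a b) = tensor a' b'"
  using assms(3)
proof (induction \<alpha>)
  case Nil
  then show ?case using assms by auto
next
  case (Cons i \<alpha>)
  then obtain a' b' where *: "smooth1 a'" "smooth1 b'" "partials \<alpha> (tensor a b) = tensor a' b'"
    by auto
  have "i = e1 \<or> i = e2"
    using Cons.prems by (auto simp: Basis_plane)
  then show ?case
    using * by (metis partial_tensor smooth1_deriv partials.simps(2))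
qed

lemma smooth_tensor:
  assumes "smooth1 a" "smooth1 b"
  shows "smooth (tensor a b)"
  unfolding smooth_def
proof (intro allI impI)
  fix \<alpha> :: "(real \<times> real) list" and x
  assume "set \<alpha> \<subseteq> Basis"
  then obtain a' b' where *: "smooth1 a'" "smooth1 b'" "partials \<alpha> (tensor a b) = tensor a' b'"
    using partials_tensor[OF assms] by blast
  show "partials \<alpha> (tensor a b) differentiable at x"
    unfolding *(3) by (rule differentiableI[OF tensor_has_derivative[OF *(1,2)]])
qed

lemma supported_in_subset:
  "supported_in p q f \<Longrightarrow> r \<le> p \<Longrightarrow> q \<le> s \<Longrightarrow> supported_in r s f"
  unfolding supported_in_def by (meson le_less_trans less_le_trans)

lemma supported_in_mult: "supported_in p q f \<Longrightarrow> supported_in p q (\<lambda>x. f x * g x)"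
  unfolding supported_in_def by fastforce

lemma supported_inD: "supported_in p q f \<Longrightarrow> x \<notin> {p<..<q} \<Longrightarrow> f x = 0"
  unfolding supported_in_def by force

lemma tensor_test_function:
  assumes "smooth1 a" "smooth1 b" "supported_in 0 1 a" "supported_in 0 1 b"
  shows "tensor a b \<in> test_functions unit_square"
proof -
  obtain p q where a: "0 < p" "q < 1" "\<And>x. x \<notin> {p..q} \<Longrightarrow> a x = 0"
    using assms(3) unfolding supported_in_def by blast
  obtain r s where b: "0 < r" "s < 1" "\<And>x. x \<notin> {r..s} \<Longrightarrow> b x = 0"
    using assms(4) unfolding supported_in_def by blast
  have "compact ({p..q} \<times> {r..s})" "{p..q} \<times> {r..s} \<subseteq> unit_square"
    using a b by (auto simp: unit_square_def intro!: compact_Times)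
  moreover have "tensor a b x = 0" if "x \<notin> {p..q} \<times> {r..s}" for x
    using that a(3)[of "fst x"] b(3)[of "snd x"] by (cases x) (auto simp: tensor_def)
  ultimately show ?thesis
    using smooth_tensor[OF assms(1,2)] by (auto simp: test_functions_def)
qed

lemma tensor_measurable:
  "a \<in> borel_measurable borel \<Longrightarrow> b \<in> borel_measurable borel \<Longrightarrow> tensor a b \<in> borel_measurable borel"
  unfolding tensor_def borel_prod[symmetric]
  by (intro borel_measurable_times measurable_compose[OF measurable_fst]
      measurable_compose[OF measurable_snd])

section \<open>Integration by parts\<close>

lemma smooth_differentiable: "smooth f \<Longrightarrow> f differentiable (at x)"
  unfolding smooth_def by (metis empty_subsetI list.set(1) partials.simps(1))

lemma smooth_partial_differentiable: "smooth f \<Longrightarrow> i \<in> Basis \<Longrightarrow> partial i f differentiable (at x)"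
  unfolding smooth_def
  by (drule spec[of _ "[i]"]) auto

lemma differentiable_imp_continuous:
  fixes f :: "'a::real_normed_vector \<Rightarrow> real"
  shows "(\<And>x. f differentiable (at x)) \<Longrightarrow> continuous_on UNIV f"
  by (simp add: continuous_at_imp_continuous_on differentiable_imp_continuous_within)

text \<open>
  Fubini on the closed square and the fundamental theorem of calculus along the lines in direction
  \<open>i\<close>, at whose end points \<open>f\<close> vanishes.
\<close>

lemma integral_partial_zero:
  fixes f :: "real \<times> real \<Rightarrow> real"
  assumes f: "\<And>x. f differentiable (at x)" and cont: "continuous_on UNIV (partial i f)"
    and zero: "\<And>x. x \<notin> unit_square \<Longrightarrow> f x = 0" and i: "i \<in> Basis"
  shows "(\<integral>x. partial i f x \<partial>square_measure) = 0"
proof -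
  have fd: "(f has_derivative frechet_derivative f (at x)) (at x)" for x
    using f frechet_derivative_works by blast
  have lin: "linear (frechet_derivative f (at x))" for x
    using f by (rule linear_frechet_derivative)
  have d1: "((\<lambda>s. f (s, y)) has_vector_derivative partial e1 f (s, y)) (at s within A)" for s y A
  proof -
    have "((\<lambda>s. (s, y)) has_derivative (\<lambda>h. (h, 0))) (at s within A)"
      by (auto intro!: derivative_eq_intros)
    then have "((\<lambda>s. f (s, y)) has_derivative (\<lambda>h. frechet_derivative f (at (s, y)) (h, 0))) (at s within A)"
      by (rule has_derivative_compose[OF _ fd])
    moreover have "frechet_derivative f (at (s, y)) (h, 0) = h *\<^sub>R partial e1 f (s, y)" for h
      using linear_scale[OF lin, of "(s, y)" h "(1, 0)"] by (simp add: partial_def)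
    ultimately show ?thesis
      by (simp add: has_vector_derivative_def)
  qed
  have d2: "((\<lambda>s. f (y, s)) has_vector_derivative partial e2 f (y, s)) (at s within A)" for s y A
  proof -
    have "((\<lambda>s. (y, s)) has_derivative (\<lambda>h. (0, h))) (at s within A)"
      by (auto intro!: derivative_eq_intros)
    then have "((\<lambda>s. f (y, s)) has_derivative (\<lambda>h. frechet_derivative f (at (y, s)) (0, h))) (at s within A)"
      by (rule has_derivative_compose[OF _ fd])
    moreover have "frechet_derivative f (at (y, s)) (0, h) = h *\<^sub>R partial e2 f (y, s)" for h
      using linear_scale[OF lin, of "(y, s)" h "(0, 1)"] by (simp add: partial_def)
    ultimately show ?thesis
      by (simp add: has_vector_derivative_def)
  qed
  have cont': "continuous_on (cbox (0,0) (1,1)) (\<lambda>(s,t). partial i f (s,t))"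
    using continuous_on_subset[OF cont] by (simp add: case_prod_unfold)
  have "(\<integral>x. partial i f x \<partial>square_measure) = integral (cbox (0,0) (1,1)) (partial i f)"
    using lebesgue_integral_eq_integral[OF integrable_square_continuous[OF cont] unit_square_sets]
    by (simp add: unit_square_eq_box integral_open_interval)
  also have "\<dots> = integral (cbox 0 1) (\<lambda>s. integral (cbox 0 1) (\<lambda>t. partial i f (s, t)))"
    using continuous_on_subset[OF cont] by (intro integral_prod_continuous) auto
  also have "\<dots> = 0"
  proof (cases "i = e1")
    case True
    have "integral (cbox 0 1) (\<lambda>s. partial e1 f (s, t)) = 0" for t
    proof (rule integral_unique)
      have "((\<lambda>s. partial e1 f (s, t)) has_integral f (1, t) - f (0, t)) {0..1}"
        by (intro fundamental_theorem_of_calculus d1) simp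
      then show "((\<lambda>s. partial e1 f (s, t)) has_integral 0) (cbox 0 1)"
        using zero[of "(1, t)"] zero[of "(0, t)"] by (simp add: unit_square_def)
    qed
    then show ?thesis
      using integral_swap_continuous[OF cont'] True by simp
  next
    case False
    then have "i = e2"
      using i by (auto simp: Basis_plane)
    moreover have "integral (cbox 0 1) (\<lambda>t. partial e2 f (s, t)) = 0" for s
    proof (rule integral_unique)
      have "((\<lambda>t. partial e2 f (s, t)) has_integral f (s, 1) - f (s, 0)) {0..1}"
        by (intro fundamental_theorem_of_calculus d2) simp
      then show "((\<lambda>t. partial e2 f (s, t)) has_integral 0) (cbox 0 1)"
        using zero[of "(s, 1)"] zero[of "(s, 0)"] by (simp add: unit_square_def)
    qed
    ultimately show ?thesis
      by simp
  qed
  finally show ?thesis .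
qed

lemma partial_mult:
  fixes f g :: "'a::euclidean_space \<Rightarrow> real"
  assumes "f differentiable (at x)" "g differentiable (at x)"
  shows "partial i (\<lambda>x. f x * g x) x = f x * partial i g x + partial i f x * g x"
proof -
  have "((\<lambda>x. f x * g x) has_derivative
      (\<lambda>h. f x * frechet_derivative g (at x) h + frechet_derivative f (at x) h * g x)) (at x)"
    using assms by (intro has_derivative_mult) (simp_all flip: frechet_derivative_works)
  from frechet_derivative_at[OF this, symmetric] show ?thesis
    by (simp add: partial_def)
qed

lemma test_function_smooth: "\<phi> \<in> test_functions \<Omega> \<Longrightarrow> smooth \<phi>"
  and test_function_outside: "\<phi> \<in> test_functions \<Omega> \<Longrightarrow> x \<notin> \<Omega> \<Longrightarrow> \<phi> x = 0"
  by (auto simp: test_functions_def)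

text \<open>
  Only one of the two factors has to vanish at the boundary. That \<open>f\<close> is arbitrary there is what later
  encodes the zero boundary values of elements of \<open>H\<^sup>1\<^sub>0\<close>.
\<close>

lemma test_function_by_parts:
  assumes \<phi>: "\<phi> \<in> test_functions unit_square" and f: "smooth f" and i: "i \<in> Basis"
  shows "(\<integral>x. \<phi> x * partial i f x \<partial>square_measure) = - (\<integral>x. partial i \<phi> x * f x \<partial>square_measure)"
proof -
  note [continuous_intros] =
    differentiable_imp_continuous[OF smooth_differentiable[OF f]]
    differentiable_imp_continuous[OF smooth_partial_differentiable[OF f i]]
    differentiable_imp_continuous[OF smooth_differentiable[OF test_function_smooth[OF \<phi>]]]
    differentiable_imp_continuous[OF smooth_partial_differentiable[OF test_function_smooth[OF \<phi>] i]]
  have eq: "partial i (\<lambda>x. \<phi> x * f x) = (\<lambda>x. \<phi> x * partial i f x + partial i \<phi> x * f x)"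
    using partial_mult smooth_differentiable test_function_smooth[OF \<phi>] f by blast
  have "(\<integral>x. partial i (\<lambda>x. \<phi> x * f x) x \<partial>square_measure) = 0"
  proof (rule integral_partial_zero[OF _ _ _ i])
    show "(\<lambda>x. \<phi> x * f x) differentiable at x" for x
      by (intro differentiable_mult smooth_differentiable test_function_smooth[OF \<phi>] f)
    show "continuous_on UNIV (partial i (\<lambda>x. \<phi> x * f x))"
      unfolding eq by (intro continuous_intros)
    show "\<phi> x * f x = 0" if "x \<notin> unit_square" for x
      using test_function_outside[OF \<phi> that] by simp
  qed
  moreover have "integrable square_measure (\<lambda>x. \<phi> x * partial i f x)"
    "integrable square_measure (\<lambda>x. partial i \<phi> x * f x)"
    by (intro integrable_square_continuous continuous_intros)+
  ultimately show ?thesis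
    unfolding eq by simp
qed

lemma test_function_integrable:
  assumes \<phi>: "\<phi> \<in> test_functions unit_square" and i: "i \<in> Basis"
  shows "integrable square_measure \<phi>" "integrable square_measure (partial i \<phi>)"
  using differentiable_imp_continuous[OF smooth_differentiable[OF test_function_smooth[OF \<phi>]]]
    differentiable_imp_continuous[OF smooth_partial_differentiable[OF test_function_smooth[OF \<phi>] i]]
  by (simp_all add: integrable_square_continuous)

lemma has_weak_deriv_test_function:
  assumes \<phi>: "\<phi> \<in> test_functions unit_square" and i: "i \<in> Basis"
  shows "has_weak_deriv unit_square [i] \<phi> (partial i \<phi>)"
  unfolding has_weak_deriv_def
  using test_function_integrable[OF assms] test_function_by_parts[OF \<phi> _ i]
  by (auto simp: locally_integrable_square test_function_smooth)

section \<open>Functions determined by their integrals over rectangles\<close>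

text \<open>
  The sets over which \<open>f\<close> integrates to zero form a Dynkin system that contains the
  intersection-stable generator of all boxes, hence all Borel sets.
\<close>

lemma AE_zero_if_box_integrals_zero_borel:
  fixes f :: "'a::euclidean_space \<Rightarrow> real"
  assumes f: "integrable lborel f" and box: "\<And>a b. (LINT x:box a b|lborel. f x) = 0"
  shows "AE x in lborel. f x = 0"
proof (rule density_unique_real[OF f integrable_zero])
  have si: "set_integrable lborel A f" if "A \<in> sets borel" for A
    using f that unfolding set_integrable_def by (intro integrable_mult_indicator) auto
  have total: "(LINT x|lborel. f x) = 0"
  proof (rule LIMSEQ_unique)
    let ?A = "\<lambda>n::nat. box (- (real n *\<^sub>R One)) (real n *\<^sub>R One) :: 'a set"
    show "(\<lambda>n. LINT x|lborel. indicator (?A n) x *\<^sub>R f x) \<longlonglongrightarrow> (LINT x|lborel. f x)"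
    proof (rule integral_dominated_convergence)
      show "integrable lborel (\<lambda>x. norm (f x))" "f \<in> borel_measurable lborel"
        using f by auto
      show "(\<lambda>x. indicator (?A n) x *\<^sub>R f x) \<in> borel_measurable lborel" for n
        using f by auto
      show "AE x in lborel. norm (indicator (?A n) x *\<^sub>R f x) \<le> norm (f x)" for n
        by (auto simp: indicator_def)
      have "(\<lambda>n. indicator (?A n) x *\<^sub>R f x) \<longlonglongrightarrow> f x" for x
      proof (rule tendsto_eventually)
        obtain m where "x \<in> ?A m"
          using UN_box_eq_UNIV by blast
        moreover have "?A m \<subseteq> ?A n" if "m \<le> n" for n
          using that by (intro subset_box_imp) auto
        ultimately show "eventually (\<lambda>n. indicator (?A n) x *\<^sub>R f x = f x) sequentially"
          unfolding eventually_sequentially by (intro exI[of _ m]) (auto simp: indicator_def)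
      qed
      then show "AE x in lborel. (\<lambda>n. indicator (?A n) x *\<^sub>R f x) \<longlonglongrightarrow> f x"
        by simp
    qed
    show "(\<lambda>n. LINT x|lborel. indicator (?A n) x *\<^sub>R f x) \<longlonglongrightarrow> 0"
      using box by (simp add: set_lebesgue_integral_def)
  qed
  fix A :: "'a set" assume "A \<in> sets lborel"
  then have A: "A \<in> sigma_sets UNIV (range (\<lambda>(a, b). box a b))"
    by (simp add: borel_eq_box)
  have stable: "Int_stable (range (\<lambda>(a, b). box a b :: 'a set))"
    by (auto simp: Int_stable_def box_Int_box)
  have sets: "sigma_sets UNIV (range (\<lambda>(a, b). box a b :: 'a set)) = sets borel"
    by (simp add: borel_eq_box)
  have "range (\<lambda>(a, b). box a b :: 'a set) \<subseteq> Pow UNIV"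
    by simp
  from stable this A have "(LINT x:A|lborel. f x) = 0"
  proof (induction rule: sigma_sets_induct_disjoint)
    case (basic A)
    then show ?case using box by auto
  next
    case empty
    then show ?case by (simp add: set_lebesgue_integral_def)
  next
    case (compl A)
    then have A: "A \<in> sets borel" "UNIV - A \<in> sets borel"
      using sets by auto
    have "(LINT x:A \<union> (UNIV - A)|lborel. f x) = (LINT x:A|lborel. f x) + (LINT x:UNIV - A|lborel. f x)"
      by (intro set_integral_Un si A) auto
    moreover have "(LINT x:A \<union> (UNIV - A)|lborel. f x) = 0"
      using total by (simp add: set_lebesgue_integral_def)
    ultimately show ?case
      using compl sets by simp
  next
    case (union A)
    then have "range A \<subseteq> sets borel"
      using sets by auto
    then have "(LINT x:(\<Union>i. A i)|lborel. f x) = (\<Sum>i. LINT x:A i|lborel. f x)"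
      using union(1) by (intro lebesgue_integral_countable_add si) (auto simp: disjoint_family_on_def)
    then show ?case
      using union sets by simp
  qed
  then show "(LINT x:A|lborel. f x) = (LINT x:A|lborel. 0)"
    by simp
qed

text \<open>
  The passage from Borel to Lebesgue measurable functions through a Borel representative.
\<close>

lemma AE_zero_if_box_integrals_zero:
  fixes f :: "'a::euclidean_space \<Rightarrow> real"
  assumes f: "integrable lebesgue f" and box: "\<And>a b. (\<integral>x. indicator (box a b) x * f x \<partial>lebesgue) = 0"
  shows "AE x in lebesgue. f x = 0"
proof -
  have fm: "f \<in> borel_measurable lebesgue"
    using f by auto
  from completion_ex_borel_measurable_real[OF fm] obtain g
    where g: "g \<in> borel_measurable lborel" and ae: "AE x in lborel. f x = g x"
    by blast
  have ae': "AE x in lebesgue. f x = g x"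
    using ae by (rule AE_completion)
  have gm: "g \<in> borel_measurable lebesgue"
    using g by (rule measurable_completion)
  have "integrable lebesgue g"
    using integrable_cong_AE[OF fm gm ae'] f by simp
  then have gi: "integrable lborel g"
    using integrable_completion[OF g] by simp
  have "(LINT x:box a b|lborel. g x) = 0" for a b
  proof -
    have "(LINT x:box a b|lborel. g x) = (\<integral>x. indicator (box a b) x * g x \<partial>lebesgue)"
      unfolding set_lebesgue_integral_def real_scaleR_def
      by (intro integral_completion[symmetric] borel_measurable_times borel_measurable_indicator g) simp
    also have "\<dots> = (\<integral>x. indicator (box a b) x * f x \<partial>lebesgue)"
      using ae' fm gm by (intro integral_cong_AE borel_measurable_times borel_measurable_indicator) auto
    finally show ?thesis
      using box by simp
  qed
  then have "AE x in lebesgue. g x = 0"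
    by (intro AE_completion AE_zero_if_box_integrals_zero_borel[OF gi])
  with ae' show ?thesis
    by eventually_elim simp
qed

lemma indicator_Ioo_measurable [simp]: "indicator {p<..<q::real} \<in> borel_measurable borel"
  by simp

lemma AE_zero_if_rectangle_integrals_zero:
  assumes h: "integrable square_measure h"
    and rect: "\<And>p q r s. (\<integral>x. h x * tensor (indicator {p<..<q}) (indicator {r<..<s}) x \<partial>square_measure) = 0"
  shows "AE x in square_measure. h x = 0"
proof -
  have "AE x in lebesgue. indicator unit_square x *\<^sub>R h x = 0"
  proof (rule AE_zero_if_box_integrals_zero)
    show "integrable lebesgue (\<lambda>x. indicator unit_square x *\<^sub>R h x)"
      using h by (simp add: integrable_restrict_space)
    fix a b :: "real \<times> real"
    have *: "indicator (box a b) x * (indicator unit_square x *\<^sub>R h x) = indicator unit_square x *\<^sub>R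
        (h x * tensor (indicator {fst a<..<fst b}) (indicator {snd a<..<snd b}) x)" for x
      by (cases x) (auto simp: tensor_def indicator_def box_prod)
    show "(\<integral>x. indicator (box a b) x * (indicator unit_square x *\<^sub>R h x) \<partial>lebesgue) = 0"
      unfolding * using rect by (simp add: integral_restrict_space)
  qed
  then show ?thesis
    by (auto simp: AE_restrict_space_iff indicator_def elim!: eventually_mono)
qed

section \<open>Integrating against tensor products\<close>

text \<open>
  Bounds are needed on the unit interval only; smooth functions are in general unbounded on the line.
\<close>

definition bounded_on_unit :: "(real \<Rightarrow> real) \<Rightarrow> real \<Rightarrow> bool" where
  "bounded_on_unit a C \<longleftrightarrow> (\<forall>x\<in>{0<..<1}. \<bar>a x\<bar> \<le> C)"

lemma bounded_tensor:
  assumes "bounded_on_unit a C" "bounded_on_unit b D" "x \<in> unit_square"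
  shows "\<bar>tensor a b x\<bar> \<le> C * D"
proof -
  have "\<bar>a (fst x)\<bar> \<le> C" "\<bar>b (snd x)\<bar> \<le> D"
    using assms by (auto simp: bounded_on_unit_def unit_square_def)
  then show ?thesis
    unfolding tensor_def abs_mult by (intro mult_mono) auto
qed

lemma square_times_tensor_measurable:
  assumes "h \<in> borel_measurable square_measure" "a \<in> borel_measurable borel" "b \<in> borel_measurable borel"
  shows "(\<lambda>x. h x * tensor a b x) \<in> borel_measurable square_measure"
  by (rule borel_measurable_times[OF assms(1) measurable_square[OF tensor_measurable[OF assms(2,3)]]])

lemma integrable_times_tensor:
  assumes "integrable square_measure h" "a \<in> borel_measurable borel" "b \<in> borel_measurable borel"
    "bounded_on_unit a C" "bounded_on_unit b D"
  shows "integrable square_measure (\<lambda>x. h x * tensor a b x)"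
proof (rule Bochner_Integration.integrable_bound)
  show "integrable square_measure (\<lambda>x. \<bar>h x\<bar> * (C * D))"
    using assms by (intro integrable_mult_left integrable_abs)
  show "(\<lambda>x. h x * tensor a b x) \<in> borel_measurable square_measure"
    using assms by (intro square_times_tensor_measurable) auto
  have "\<bar>h x * tensor a b x\<bar> \<le> \<bar>h x\<bar> * (C * D)" if "x \<in> unit_square" for x
    unfolding abs_mult using bounded_tensor[OF assms(4,5) that] by (rule mult_left_mono) simp
  then show "AE x in square_measure. norm (h x * tensor a b x) \<le> norm (\<bar>h x\<bar> * (C * D))"
    by (intro AE_I2) (force intro: order_trans[OF _ abs_ge_self])
qed

text \<open>
  Dominated convergence with dominating function \<open>\<bar>h\<bar> C D\<close>. No derivative of \<open>a n\<close> or \<open>b n\<close> enters, which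
  is why cut-off functions with exploding derivatives are harmless in what follows.
\<close>

lemma tensor_limit:
  assumes h: "integrable square_measure h"
    and a: "\<And>n. a n \<in> borel_measurable borel" "\<And>n. bounded_on_unit (a n) C"
      "a' \<in> borel_measurable borel" "\<And>x. x \<in> {0<..<1} \<Longrightarrow> (\<lambda>n. a n x) \<longlonglongrightarrow> a' x"
    and b: "\<And>n. b n \<in> borel_measurable borel" "\<And>n. bounded_on_unit (b n) D"
      "b' \<in> borel_measurable borel" "\<And>x. x \<in> {0<..<1} \<Longrightarrow> (\<lambda>n. b n x) \<longlonglongrightarrow> b' x"
  shows "(\<lambda>n. \<integral>x. h x * tensor (a n) (b n) x \<partial>square_measure)
    \<longlonglongrightarrow> (\<integral>x. h x * tensor a' b' x \<partial>square_measure)"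
proof (rule integral_dominated_convergence)
  have hm: "h \<in> borel_measurable square_measure"
    using h by auto
  show "(\<lambda>x. h x * tensor a' b' x) \<in> borel_measurable square_measure"
    "(\<lambda>x. h x * tensor (a n) (b n) x) \<in> borel_measurable square_measure" for n
    using hm a b by (intro square_times_tensor_measurable; simp)+
  show "integrable square_measure (\<lambda>x. \<bar>h x\<bar> * (C * D))"
    using h by (intro integrable_mult_left integrable_abs)
  have "\<bar>h x * tensor (a n) (b n) x\<bar> \<le> \<bar>h x\<bar> * (C * D)" if "x \<in> unit_square" for x n
    unfolding abs_mult using bounded_tensor[OF a(2) b(2) that] by (rule mult_left_mono) simp
  then show "AE x in square_measure. norm (h x * tensor (a n) (b n) x) \<le> \<bar>h x\<bar> * (C * D)" for n
    by (intro AE_I2) auto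
  have "(\<lambda>n. h x * tensor (a n) (b n) x) \<longlonglongrightarrow> h x * tensor a' b' x" if "x \<in> unit_square" for x
    unfolding tensor_def using that by (intro tendsto_intros a b) (auto simp: unit_square_def)
  then show "AE x in square_measure. (\<lambda>n. h x * tensor (a n) (b n) x) \<longlonglongrightarrow> h x * tensor a' b' x"
    by (intro AE_I2) auto
qed

lemma smooth1_bounded_on_unit:
  assumes "smooth1 a" obtains C where "bounded_on_unit a C"
proof -
  have "compact (a ` {0..1})"
    using assms by (intro compact_continuous_image smooth1_continuous) auto
  then obtain C where "\<And>x. x \<in> {0..1} \<Longrightarrow> \<bar>a x\<bar> \<le> C"
    using compact_imp_bounded bounded_iff by (metis imageI real_norm_def)
  then show thesis
    by (intro that[of C]) (auto simp: bounded_on_unit_def)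
qed

lemma bounded_on_unit_mult:
  "bounded_on_unit a C \<Longrightarrow> bounded_on_unit b D \<Longrightarrow> bounded_on_unit (\<lambda>x. a x * b x) (C * D)"
  unfolding bounded_on_unit_def abs_mult by (meson abs_ge_zero mult_mono order_trans)

section \<open>Uniqueness of weak derivatives\<close>

text \<open>
  Tensor products of smooth bumps converge to indicators of rectangles, so two weak derivatives have
  the same integral over every rectangle. As they are only locally integrable, this is done on smaller
  squares \<open>K\<close> that exhaust the unit square.
\<close>

lemma has_weak_deriv_unique:
  assumes g: "has_weak_deriv unit_square \<alpha> f g" and g': "has_weak_deriv unit_square \<alpha> f g'"
  shows "AE x in square_measure. g x = g' x"
proof -
  have sub: "AE x in square_measure. x \<in> {e<..<1 - e} \<times> {e<..<1 - e} \<longrightarrow> g x = g' x" if "e > 0" for e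
  proof -
    define K where "K = {e<..<1 - e} \<times> {e<..<1 - e}"
    have K: "K = box (e, e) (1 - e, 1 - e)" "K \<subseteq> unit_square"
      using \<open>e > 0\<close> by (auto simp: K_def box_prod unit_square_def)
    then have Ks: "K \<in> sets lebesgue"
      by (simp add: fmeasurableD)
    have int: "integrable square_measure (\<lambda>x. indicator K x * k x)"
      if "has_weak_deriv unit_square \<alpha> f k" for k
    proof -
      have "cbox (e, e) (1 - e, 1 - e) \<subseteq> unit_square"
        using \<open>e > 0\<close> by (auto simp: unit_square_def cbox_Pair_eq)
      then have "integrable (lebesgue_on (cbox (e, e) (1 - e, 1 - e))) k"
        using that by (auto simp: has_weak_deriv_def locally_integrable_def)
      then have "integrable (lebesgue_on K) k"
        by (rule integrable_lebesgue_on_subset) (auto simp: K box_subset_cbox)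
      then have "integrable lebesgue (\<lambda>x. indicator K x *\<^sub>R k x)"
        using Ks by (simp add: integrable_restrict_space)
      also have "(\<lambda>x. indicator K x *\<^sub>R k x) = (\<lambda>x. indicator unit_square x *\<^sub>R (indicator K x * k x))"
        using K(2) by (auto simp: indicator_def fun_eq_iff)
      finally show ?thesis
        by (simp add: integrable_restrict_space)
    qed
    note ints = int[OF g] int[OF g']
    have "AE x in square_measure. indicator K x * g x - indicator K x * g' x = 0"
    proof (rule AE_zero_if_rectangle_integrals_zero)
      show "integrable square_measure (\<lambda>x. indicator K x * g x - indicator K x * g' x)"
        using ints by (rule Bochner_Integration.integrable_diff)
      fix p q r s :: real
      \<comment> \<open>the rectangle is intersected with \<open>K\<close>, so that the bumps are test functions\<close>
      define p' q' r' s' where "p' = max p e" "q' = min q (1 - e)" "r' = max r e" "s' = min s (1 - e)"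
      obtain \<eta> where \<eta>: "\<And>n. smooth1 (\<eta> n)" "\<And>n. supported_in p' q' (\<eta> n)"
        "\<And>n x. 0 \<le> \<eta> n x" "\<And>n x. \<eta> n x \<le> 1" "\<And>x. (\<lambda>n. \<eta> n x) \<longlonglongrightarrow> indicator {p'<..<q'} x"
        using smooth_approx_indicator[of p' q'] by blast
      obtain \<zeta> where \<zeta>: "\<And>n. smooth1 (\<zeta> n)" "\<And>n. supported_in r' s' (\<zeta> n)"
        "\<And>n x. 0 \<le> \<zeta> n x" "\<And>n x. \<zeta> n x \<le> 1" "\<And>x. (\<lambda>n. \<zeta> n x) \<longlonglongrightarrow> indicator {r'<..<s'} x"
        using smooth_approx_indicator[of r' s'] by blast
      have lim: "(\<lambda>n. \<integral>x. indicator K x * k x * tensor (\<eta> n) (\<zeta> n) x \<partial>square_measure) \<longlonglongrightarrow>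
          (\<integral>x. indicator K x * k x * tensor (indicator {p'<..<q'}) (indicator {r'<..<s'}) x \<partial>square_measure)"
        if "integrable square_measure (\<lambda>x. indicator K x * k x)" for k
        using that \<eta> \<zeta> by (intro tensor_limit[where C = 1 and D = 1])
          (auto simp: bounded_on_unit_def smooth1_measurable)
      have "(\<integral>x. indicator K x * g x * tensor (\<eta> n) (\<zeta> n) x \<partial>square_measure) =
          (\<integral>x. indicator K x * g' x * tensor (\<eta> n) (\<zeta> n) x \<partial>square_measure)" for n
      proof -
        have zero: "\<eta> n (fst x) = 0 \<or> \<zeta> n (snd x) = 0" if "x \<notin> K" for x
          using that supported_inD[OF \<eta>(2)[of n], of "fst x"] supported_inD[OF \<zeta>(2)[of n], of "snd x"]
          by (cases x) (auto simp: K_def p'_q'_r'_s'_def)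
        have eq: "indicator K x * k x * tensor (\<eta> n) (\<zeta> n) x = k x * tensor (\<eta> n) (\<zeta> n) x" for k x
          by (cases "x \<in> K") (use zero[of x] in \<open>auto simp: tensor_def\<close>)
        have "tensor (\<eta> n) (\<zeta> n) \<in> test_functions unit_square"
          using \<open>e > 0\<close> by (intro tensor_test_function \<eta> \<zeta> supported_in_subset[OF \<eta>(2)] supported_in_subset[OF \<zeta>(2)])
            (auto simp: p'_q'_r'_s'_def)
        then show ?thesis
          unfolding eq using g g' by (auto simp: has_weak_deriv_def)
      qed
      then have *: "(\<integral>x. indicator K x * g x * tensor (indicator {p'<..<q'}) (indicator {r'<..<s'}) x \<partial>square_measure)
        = (\<integral>x. indicator K x * g' x * tensor (indicator {p'<..<q'}) (indicator {r'<..<s'}) x \<partial>square_measure)"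
        using lim[OF ints(1)] lim[OF ints(2)] by (simp add: LIMSEQ_unique)
      have eq: "indicator K x * k x * tensor (indicator {p'<..<q'}) (indicator {r'<..<s'}) x =
        indicator K x * k x * tensor (indicator {p<..<q}) (indicator {r<..<s}) x" for k and x :: "real \<times> real"
        by (cases x) (auto simp: tensor_def indicator_def K_def p'_q'_r'_s'_def)
      have "integrable square_measure (\<lambda>x. indicator K x * k x * tensor (indicator {p<..<q}) (indicator {r<..<s}) x)"
        if "integrable square_measure (\<lambda>x. indicator K x * k x)" for k
        using that by (intro integrable_times_tensor[where C = 1 and D = 1]) (auto simp: bounded_on_unit_def indicator_def)
      then show "(\<integral>x. (indicator K x * g x - indicator K x * g' x) *
          tensor (indicator {p<..<q}) (indicator {r<..<s}) x \<partial>square_measure) = 0"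
        using * ints unfolding eq by (simp add: left_diff_distrib)
    qed
    then show ?thesis
      unfolding K_def[symmetric] by eventually_elim (auto simp: indicator_def)
  qed
  have "AE x in square_measure. \<forall>n::nat.
      x \<in> {inverse (Suc n)<..<1 - inverse (Suc n)} \<times> {inverse (Suc n)<..<1 - inverse (Suc n)} \<longrightarrow> g x = g' x"
    unfolding AE_all_countable by (intro allI sub) simp
  moreover have "AE x in square_measure. x \<in> unit_square"
    by (intro AE_I2) simp
  ultimately show ?thesis
  proof eventually_elim
    case (elim x)
    define d where "d = Min {fst x, 1 - fst x, snd x, 1 - snd x}"
    have "d > 0"
      using elim(2) by (auto simp: d_def unit_square_def)
    then obtain n where n: "inverse (Suc n) < d"
      using reals_Archimedean by blast
    then show ?case
      using elim(1) by (cases x) (auto simp: d_def)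
  qed
qed

section \<open>Square-integrable functions on the unit square\<close>

text \<open>
  The Cauchy-Schwarz inequality against an indicator: the integral of \<open>(f - t 1\<^sub>A)\<^sup>2\<close> is nonnegative, and
  the mean value \<open>t\<close> of \<open>f\<close> over \<open>A\<close> is the best choice.
\<close>

lemma (in finite_measure) square_set_integral_le:
  fixes f :: "'a \<Rightarrow> real"
  assumes f: "f \<in> borel_measurable M" "integrable M (\<lambda>x. (f x)\<^sup>2)"
    and A: "A \<in> sets M" "measure M A > 0"
  shows "(\<integral>x. f x * indicator A x \<partial>M)\<^sup>2 \<le> measure M A * (\<integral>x. (f x)\<^sup>2 \<partial>M)"
proof -
  define I where "I = (\<integral>x. f x * indicator A x \<partial>M)"
  define t where "t = I / measure M A"
  have int: "integrable M f"
    by (rule square_integrable_imp_integrable[OF f])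
  have fA: "integrable M (\<lambda>x. f x * indicator A x)"
    using A(1) int by (rule integrable_real_mult_indicator)
  have iA: "integrable M (indicator A :: 'a \<Rightarrow> real)"
    using A(1) by (intro integrable_real_indicator) (simp_all add: less_top[symmetric])
  have "0 \<le> (\<integral>x. (f x - t * indicator A x)\<^sup>2 \<partial>M)"
    by simp
  also have "\<dots> = (\<integral>x. (f x)\<^sup>2 - 2 * t * (f x * indicator A x) + t\<^sup>2 * indicator A x \<partial>M)"
    by (intro Bochner_Integration.integral_cong) (auto simp: power2_eq_square algebra_simps indicator_def)
  also have "\<dots> = (\<integral>x. (f x)\<^sup>2 \<partial>M) - 2 * t * I + t\<^sup>2 * measure M A"
    using f(2) fA iA A(1) by (simp add: I_def)
  also have "\<dots> = (\<integral>x. (f x)\<^sup>2 \<partial>M) - I\<^sup>2 / measure M A"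
    using A(2) by (simp add: t_def power2_eq_square field_simps)
  finally show ?thesis
    using A(2) by (simp add: I_def field_simps)
qed

lemma L2_norm_square: "(L2_norm \<Omega> f)\<^sup>2 = (\<integral>x. (f x)\<^sup>2 \<partial>lebesgue_on \<Omega>)"
  by (simp add: L2_norm_def)

lemma L2_norm_nonneg: "0 \<le> L2_norm \<Omega> f"
  by (simp add: L2_norm_def)

lemma L2_measurable: "f \<in> L2_space \<Omega> \<Longrightarrow> f \<in> borel_measurable (lebesgue_on \<Omega>)"
  and L2_square_integrable: "f \<in> L2_space \<Omega> \<Longrightarrow> integrable (lebesgue_on \<Omega>) (\<lambda>x. (f x)\<^sup>2)"
  unfolding L2_space_def by blast+

lemma integral_abs_le_L2_norm:
  assumes f: "f \<in> L2_space unit_square"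
  shows "(\<integral>x. \<bar>f x\<bar> \<partial>square_measure) \<le> L2_norm unit_square f"
proof -
  have eq: "(\<integral>x. \<bar>f x\<bar> * indicator unit_square x \<partial>square_measure) = (\<integral>x. \<bar>f x\<bar> \<partial>square_measure)"
    by (intro Bochner_Integration.integral_cong) auto
  have "(\<integral>x. \<bar>f x\<bar> * indicator unit_square x \<partial>square_measure)\<^sup>2
      \<le> measure square_measure unit_square * (\<integral>x. \<bar>f x\<bar>\<^sup>2 \<partial>square_measure)"
  proof (rule square.square_set_integral_le)
    show "(\<lambda>x. \<bar>f x\<bar>) \<in> borel_measurable square_measure"
      by (intro borel_measurable_abs L2_measurable f)
    show "integrable square_measure (\<lambda>x. \<bar>f x\<bar>\<^sup>2)"
      unfolding power2_abs by (rule L2_square_integrable[OF f])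
    show "unit_square \<in> sets square_measure"
      using sets.top[of square_measure] by simp
  qed (simp add: measure_square)
  then have "(\<integral>x. \<bar>f x\<bar> \<partial>square_measure)\<^sup>2 \<le> (L2_norm unit_square f)\<^sup>2"
    unfolding eq by (simp add: measure_square L2_norm_square)
  then show ?thesis
    by (rule power2_le_imp_le[OF _ L2_norm_nonneg])
qed

lemma L2_diff:
  assumes f: "f \<in> L2_space \<Omega>" and g: "g \<in> L2_space \<Omega>"
  shows "(\<lambda>x. f x - g x) \<in> L2_space \<Omega>"
proof -
  have m: "(\<lambda>x. f x - g x) \<in> borel_measurable (lebesgue_on \<Omega>)"
    by (intro borel_measurable_diff L2_measurable f g)
  have "integrable (lebesgue_on \<Omega>) (\<lambda>x. (f x - g x)\<^sup>2)"
  proof (rule Bochner_Integration.integrable_bound)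
    show "integrable (lebesgue_on \<Omega>) (\<lambda>x. 2 * (f x)\<^sup>2 + 2 * (g x)\<^sup>2)"
      by (intro Bochner_Integration.integrable_add integrable_mult_right L2_square_integrable f g)
    show "(\<lambda>x. (f x - g x)\<^sup>2) \<in> borel_measurable (lebesgue_on \<Omega>)"
      by (intro borel_measurable_power m)
    have "(f x - g x)\<^sup>2 \<le> 2 * (f x)\<^sup>2 + 2 * (g x)\<^sup>2" for x
      using zero_le_power2[of "f x + g x"] by (simp add: power2_eq_square algebra_simps)
    then show "AE x in lebesgue_on \<Omega>. norm ((f x - g x)\<^sup>2) \<le> norm (2 * (f x)\<^sup>2 + 2 * (g x)\<^sup>2)"
      by (intro AE_I2) simp
  qed
  with m show ?thesis
    unfolding L2_space_def by blast
qed

lemma L2_continuous: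
  assumes "continuous_on UNIV f"
  shows "f \<in> L2_space unit_square"
  unfolding L2_space_def
  using integrable_square_continuous[OF assms] integrable_square_continuous[OF continuous_on_power[OF assms]]
  by auto

lemma L2_cong_AE:
  assumes g: "g \<in> L2_space unit_square" and ae: "AE x in square_measure. g x = h x"
  shows "h \<in> L2_space unit_square" and "L2_norm unit_square h = L2_norm unit_square g"
proof -
  have "(\<lambda>x. indicator unit_square x *\<^sub>R h x) \<in> borel_measurable lebesgue"
  proof (rule borel_measurable_AE)
    show "(\<lambda>x. indicator unit_square x *\<^sub>R g x) \<in> borel_measurable lebesgue"
      using L2_measurable[OF g] by (simp add: borel_measurable_restrict_space_iff)
    have "AE x in lebesgue. x \<in> unit_square \<longrightarrow> g x = h x"
      using ae by (simp add: AE_restrict_space_iff)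
    then show "AE x in lebesgue. indicator unit_square x *\<^sub>R g x = indicator unit_square x *\<^sub>R h x"
      by eventually_elim (auto simp: indicator_def)
  qed
  then have hm: "h \<in> borel_measurable square_measure"
    by (simp add: borel_measurable_restrict_space_iff)
  have ae2: "AE x in square_measure. (g x)\<^sup>2 = (h x)\<^sup>2"
    using ae by eventually_elim simp
  note m2 = borel_measurable_power[OF L2_measurable[OF g], of 2] borel_measurable_power[OF hm, of 2]
  have "integrable square_measure (\<lambda>x. (h x)\<^sup>2)"
    using integrable_cong_AE[OF m2 ae2] L2_square_integrable[OF g] by simp
  with hm show "h \<in> L2_space unit_square"
    unfolding L2_space_def by blast
  show "L2_norm unit_square h = L2_norm unit_square g"
    using integral_cong_AE[OF m2 ae2] by (simp add: L2_norm_def)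
qed

text \<open>
  The chosen representative \<open>weak_deriv\<close> could a priori fail to be square-integrable, in which case its
  norm would be the meaningless value 0; uniqueness excludes this.
\<close>

lemma weak_deriv_L2:
  assumes "has_weak_deriv unit_square \<alpha> f g" "g \<in> L2_space unit_square"
  shows "has_weak_deriv unit_square \<alpha> f (weak_deriv unit_square \<alpha> f)"
    and "weak_deriv unit_square \<alpha> f \<in> L2_space unit_square"
    and "L2_norm unit_square (weak_deriv unit_square \<alpha> f) = L2_norm unit_square g"
proof -
  show *: "has_weak_deriv unit_square \<alpha> f (weak_deriv unit_square \<alpha> f)"
    unfolding weak_deriv_def by (rule someI[where P = "has_weak_deriv unit_square \<alpha> f", OF assms(1)])
  show "weak_deriv unit_square \<alpha> f \<in> L2_space unit_square"
    "L2_norm unit_square (weak_deriv unit_square \<alpha> f) = L2_norm unit_square g"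
    using L2_cong_AE[OF assms(2) has_weak_deriv_unique[OF assms(1) *]] by blast+
qed

lemma sobolev_weak_deriv:
  assumes "f \<in> sobolev k unit_square" "set \<alpha> \<subseteq> Basis" "length \<alpha> \<le> k"
  shows "has_weak_deriv unit_square \<alpha> f (weak_deriv unit_square \<alpha> f)"
    and "weak_deriv unit_square \<alpha> f \<in> L2_space unit_square"
  using assms weak_deriv_L2 unfolding sobolev_def by blast+

lemma continuous_bounded_on_square:
  fixes \<eta> :: "real \<times> real \<Rightarrow> real"
  assumes "continuous_on UNIV \<eta>"
  obtains C where "C > 0" "\<And>x. x \<in> unit_square \<Longrightarrow> \<bar>\<eta> x\<bar> \<le> C"
proof -
  have "compact (\<eta> ` cbox (0,0) (1,1))"
    by (intro compact_continuous_image continuous_on_subset[OF assms]) auto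
  then obtain C where "C > 0" "\<And>x. x \<in> cbox (0,0) (1,1) \<Longrightarrow> \<bar>\<eta> x\<bar> \<le> C"
    using compact_imp_bounded bounded_pos by (metis imageI real_norm_def)
  then show thesis
    using that[of C] box_subset_cbox[of "(0,0)" "(1,1)"] by (auto simp: unit_square_eq_box)
qed

lemma integrable_times_continuous:
  fixes \<eta> :: "real \<times> real \<Rightarrow> real"
  assumes h: "integrable square_measure h" and \<eta>: "continuous_on UNIV \<eta>"
  shows "integrable square_measure (\<lambda>x. h x * \<eta> x)"
proof -
  obtain C where C: "C > 0" "\<And>x. x \<in> unit_square \<Longrightarrow> \<bar>\<eta> x\<bar> \<le> C"
    using continuous_bounded_on_square[OF \<eta>] by blast
  show ?thesis
  proof (rule Bochner_Integration.integrable_bound)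
    show "integrable square_measure (\<lambda>x. \<bar>h x\<bar> * C)"
      using h by (intro integrable_mult_left integrable_abs)
    show "(\<lambda>x. h x * \<eta> x) \<in> borel_measurable square_measure"
      using h integrable_square_continuous[OF \<eta>] by (intro borel_measurable_times) auto
    have "\<bar>h x * \<eta> x\<bar> \<le> \<bar>h x\<bar> * C" if "x \<in> unit_square" for x
      unfolding abs_mult using C(2)[OF that] by (rule mult_left_mono) simp
    then show "AE x in square_measure. norm (h x * \<eta> x) \<le> norm (\<bar>h x\<bar> * C)"
      by (intro AE_I2) (force intro: order_trans[OF _ abs_ge_self])
  qed
qed

lemma integral_times_continuous_le:
  assumes h: "h \<in> L2_space unit_square" and \<eta>: "continuous_on UNIV \<eta>"
    and C: "C > 0" "\<And>x. x \<in> unit_square \<Longrightarrow> \<bar>\<eta> x\<bar> \<le> C"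
  shows "\<bar>\<integral>x. h x * \<eta> x \<partial>square_measure\<bar> \<le> C * L2_norm unit_square h"
proof -
  note int = integrable_times_continuous[OF L2_integrable[OF h] \<eta>]
  have "\<bar>\<integral>x. h x * \<eta> x \<partial>square_measure\<bar> \<le> (\<integral>x. \<bar>h x * \<eta> x\<bar> \<partial>square_measure)"
    by (rule integral_abs_bound)
  also have "\<dots> \<le> (\<integral>x. C * \<bar>h x\<bar> \<partial>square_measure)"
  proof (rule integral_mono)
    show "integrable square_measure (\<lambda>x. C * \<bar>h x\<bar>)"
      using L2_integrable[OF h] by (intro integrable_mult_right integrable_abs)
    show "\<bar>h x * \<eta> x\<bar> \<le> C * \<bar>h x\<bar>" if "x \<in> space square_measure" for x
      using mult_right_mono[OF C(2)[of x], of "\<bar>h x\<bar>"] that by (simp add: abs_mult mult.commute)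
  qed (use int in \<open>rule integrable_abs\<close>)
  also have "\<dots> \<le> C * L2_norm unit_square h"
    using integral_abs_le_L2_norm[OF h] C(1) by simp
  finally show ?thesis .
qed

lemma has_weak_deriv_diff:
  assumes "integrable square_measure f" "integrable square_measure f'"
    and "has_weak_deriv unit_square \<alpha> f g" "has_weak_deriv unit_square \<alpha> f' g'"
    and "integrable square_measure g" "integrable square_measure g'" and "set \<alpha> \<subseteq> Basis"
  shows "has_weak_deriv unit_square \<alpha> (\<lambda>x. f x - f' x) (\<lambda>x. g x - g' x)"
  unfolding has_weak_deriv_def
proof (intro conjI ballI)
  show "locally_integrable unit_square (\<lambda>x. f x - f' x)" "locally_integrable unit_square (\<lambda>x. g x - g' x)"
    using assms by (auto intro!: locally_integrable_square)
  fix \<phi> :: "real \<times> real \<Rightarrow> real" assume \<phi>: "\<phi> \<in> test_functions unit_square"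
  have "partials \<alpha> \<phi> differentiable at x" for x
    using test_function_smooth[OF \<phi>] assms(7) unfolding smooth_def by blast
  then have cp: "continuous_on UNIV (partials \<alpha> \<phi>)"
    by (rule differentiable_imp_continuous)
  have c: "continuous_on UNIV \<phi>"
    by (rule differentiable_imp_continuous[OF smooth_differentiable[OF test_function_smooth[OF \<phi>]]])
  have "(\<integral>x. f x * partials \<alpha> \<phi> x \<partial>square_measure) = (- 1) ^ length \<alpha> * (\<integral>x. g x * \<phi> x \<partial>square_measure)"
    "(\<integral>x. f' x * partials \<alpha> \<phi> x \<partial>square_measure) = (- 1) ^ length \<alpha> * (\<integral>x. g' x * \<phi> x \<partial>square_measure)"
    using assms(3,4) \<phi> unfolding has_weak_deriv_def by blast+
  then show "(\<integral>x. (f x - f' x) * partials \<alpha> \<phi> x \<partial>square_measure) =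
      (- 1) ^ length \<alpha> * (\<integral>x. (g x - g' x) * \<phi> x \<partial>square_measure)"
    unfolding left_diff_distrib
      Bochner_Integration.integral_diff[OF assms(1,2)[THEN integrable_times_continuous[OF _ cp]]]
      Bochner_Integration.integral_diff[OF assms(5,6)[THEN integrable_times_continuous[OF _ c]]]
    by (simp add: right_diff_distrib)
qed

section \<open>Integration by parts without boundary terms\<close>

text \<open>
  The zero boundary values in weak form: \<open>\<eta>\<close> may be any smooth function on the plane. The identity holds
  for test functions in place of \<open>f\<close>, and both sides are continuous in the norm of \<open>H\<^sup>1\<close>.
\<close>

lemma H10_by_parts:
  assumes f: "f \<in> sobolev_H10 unit_square" and i: "i \<in> Basis"
    and g: "has_weak_deriv unit_square [i] f g" "g \<in> L2_space unit_square"
    and \<eta>: "smooth \<eta>"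
  shows "(\<integral>x. f x * partial i \<eta> x \<partial>square_measure) = - (\<integral>x. g x * \<eta> x \<partial>square_measure)"
proof -
  have f2: "f \<in> L2_space unit_square"
    using f by (auto simp: sobolev_H10_def sobolev_def)
  have c\<eta>: "continuous_on UNIV \<eta>" and cd\<eta>: "continuous_on UNIV (partial i \<eta>)"
    by (rule differentiable_imp_continuous[OF smooth_differentiable[OF \<eta>]],
        rule differentiable_imp_continuous[OF smooth_partial_differentiable[OF \<eta> i]])
  obtain C where C: "C > 0" "\<And>x. x \<in> unit_square \<Longrightarrow> \<bar>\<eta> x\<bar> \<le> C"
    using continuous_bounded_on_square[OF c\<eta>] by blast
  obtain D where D: "D > 0" "\<And>x. x \<in> unit_square \<Longrightarrow> \<bar>partial i \<eta> x\<bar> \<le> D"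
    using continuous_bounded_on_square[OF cd\<eta>] by blast
  \<comment> \<open>the defect in the claimed identity, which is linear in \<open>f\<close> and vanishes for test functions\<close>
  define R where "R = (\<integral>x. f x * partial i \<eta> x \<partial>square_measure) + (\<integral>x. g x * \<eta> x \<partial>square_measure)"
  have small: "\<bar>R\<bar> \<le> (C + D) * e" if "e > 0" for e
  proof -
    obtain \<phi> where \<phi>: "\<phi> \<in> test_functions unit_square" and e: "H1_norm unit_square (\<lambda>x. f x - \<phi> x) < e"
      using f \<open>e > 0\<close> by (auto simp: sobolev_H10_def)
    have c\<phi>: "continuous_on UNIV \<phi>" and cd\<phi>: "continuous_on UNIV (partial i \<phi>)"
      by (rule differentiable_imp_continuous[OF smooth_differentiable[OF test_function_smooth[OF \<phi>]]],
          rule differentiable_imp_continuous[OF smooth_partial_differentiable[OF test_function_smooth[OF \<phi>] i]])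
    define k where "k x = g x - partial i \<phi> x" for x
    have k: "k \<in> L2_space unit_square"
      unfolding k_def by (intro L2_diff g L2_continuous cd\<phi>)
    have d: "(\<lambda>x. f x - \<phi> x) \<in> L2_space unit_square"
      by (intro L2_diff f2 L2_continuous c\<phi>)
    have "has_weak_deriv unit_square [i] (\<lambda>x. f x - \<phi> x) k"
      unfolding k_def using i
      by (intro has_weak_deriv_diff L2_integrable f2 g L2_continuous c\<phi> cd\<phi> has_weak_deriv_test_function \<phi>) auto
    then have nk: "L2_norm unit_square (weak_deriv unit_square [i] (\<lambda>x. f x - \<phi> x)) = L2_norm unit_square k"
      by (rule weak_deriv_L2(3)[OF _ k])
    define S where "S = (\<Sum>j\<in>Basis. (L2_norm unit_square (weak_deriv unit_square [j] (\<lambda>x. f x - \<phi> x)))\<^sup>2)"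
    have "(L2_norm unit_square k)\<^sup>2 \<le> S"
      unfolding nk[symmetric] S_def using i by (intro member_le_sum) auto
    moreover have "S \<ge> 0"
      unfolding S_def by (intro sum_nonneg) simp
    moreover have H: "H1_norm unit_square (\<lambda>x. f x - \<phi> x) = sqrt ((L2_norm unit_square (\<lambda>x. f x - \<phi> x))\<^sup>2 + S)"
      by (simp add: H1_norm_def S_def)
    moreover have "0 \<le> (L2_norm unit_square (\<lambda>x. f x - \<phi> x))\<^sup>2"
      by simp
    ultimately have "L2_norm unit_square k \<le> H1_norm unit_square (\<lambda>x. f x - \<phi> x)"
      "L2_norm unit_square (\<lambda>x. f x - \<phi> x) \<le> H1_norm unit_square (\<lambda>x. f x - \<phi> x)"
      unfolding H by (intro real_le_rsqrt; linarith)+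
    with e have less: "L2_norm unit_square k \<le> e" "L2_norm unit_square (\<lambda>x. f x - \<phi> x) \<le> e"
      by auto
    have "R = (\<integral>x. (f x - \<phi> x) * partial i \<eta> x \<partial>square_measure) + (\<integral>x. k x * \<eta> x \<partial>square_measure)"
      using test_function_by_parts[OF \<phi> \<eta> i]
        integrable_times_continuous[OF L2_integrable[OF f2] cd\<eta>]
        integrable_times_continuous[OF L2_integrable[OF L2_continuous[OF c\<phi>]] cd\<eta>]
        integrable_times_continuous[OF L2_integrable[OF g(2)] c\<eta>]
        integrable_times_continuous[OF L2_integrable[OF L2_continuous[OF cd\<phi>]] c\<eta>]
      by (simp add: R_def k_def left_diff_distrib)
    then have "\<bar>R\<bar> \<le> D * L2_norm unit_square (\<lambda>x. f x - \<phi> x) + C * L2_norm unit_square k"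
      using integral_times_continuous_le[OF d cd\<eta> D] integral_times_continuous_le[OF k c\<eta> C] by linarith
    also have "\<dots> \<le> D * e + C * e"
      using less C(1) D(1) by (intro add_mono mult_left_mono) auto
    finally show ?thesis
      by (simp add: algebra_simps)
  qed
  have "R = 0"
  proof (rule ccontr)
    assume "R \<noteq> 0"
    have "C + D > 0"
      using C(1) D(1) by simp
    with \<open>R \<noteq> 0\<close> have "\<bar>R\<bar> \<le> (C + D) * (\<bar>R\<bar> / (2 * (C + D)))"
      by (intro small) simp
    also have "\<dots> = \<bar>R\<bar> / 2"
      using \<open>C + D > 0\<close> by (simp add: field_simps)
    finally show False
      using \<open>R \<noteq> 0\<close> by simp
  qed
  then show ?thesis
    by (simp add: R_def)
qed

lemma limits_negated:
  fixes x y :: real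
  assumes "X \<longlonglongrightarrow> x" "Y \<longlonglongrightarrow> y" "\<And>n. X n = - Y n"
  shows "x = - y"
proof (rule LIMSEQ_unique[OF assms(1)])
  have "X = (\<lambda>n. - Y n)"
    using assms(3) by auto
  then show "X \<longlonglongrightarrow> - y"
    using tendsto_minus[OF assms(2)] by simp
qed

lemma H10_by_parts_tensor:
  assumes f: "f \<in> sobolev_H10 unit_square" and ab: "smooth1 a" "smooth1 b"
  shows "has_weak_deriv unit_square [e1] f g \<Longrightarrow> g \<in> L2_space unit_square \<Longrightarrow>
      (\<integral>x. f x * tensor (deriv a) b x \<partial>square_measure) = - (\<integral>x. g x * tensor a b x \<partial>square_measure)"
    and "has_weak_deriv unit_square [e2] f g \<Longrightarrow> g \<in> L2_space unit_square \<Longrightarrow>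
      (\<integral>x. f x * tensor a (deriv b) x \<partial>square_measure) = - (\<integral>x. g x * tensor a b x \<partial>square_measure)"
  using H10_by_parts[OF f _ _ _ smooth_tensor[OF ab], of e1 g] H10_by_parts[OF f _ _ _ smooth_tensor[OF ab], of e2 g]
  by (simp_all add: partial_tensor[OF ab] Basis_plane)

text \<open>
  The definition of the mixed derivative allows only compactly supported test functions, so it says
  nothing about the boundary. The restriction is removed for one variable at a time. For compactly
  supported \<open>p \<otimes> q\<close>, moving only the derivative in the second variable onto \<open>f\<close> relates \<open>g2\<close> to \<open>G\<close>
  in an identity without derivatives of \<open>q\<close>; hence \<open>q\<close> may be replaced by \<open>b\<close> through cut-off
  functions. Moving the derivatives back and now using \<open>g1\<close> gives an identity without derivatives of
  \<open>p\<close>, in which \<open>p\<close> may be replaced by \<open>a\<close> in the same way.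
\<close>

lemma mixed_by_parts:
  assumes f: "f \<in> sobolev_H10 unit_square"
    and g1: "has_weak_deriv unit_square [e1] f g1" "g1 \<in> L2_space unit_square"
    and g2: "has_weak_deriv unit_square [e2] f g2" "g2 \<in> L2_space unit_square"
    and G: "has_weak_deriv unit_square [e1, e2] f G" "G \<in> L2_space unit_square"
    and a: "smooth1 a" and b: "smooth1 b"
  shows "(\<integral>x. g1 x * tensor a (deriv b) x \<partial>square_measure) = - (\<integral>x. G x * tensor a b x \<partial>square_measure)"
proof -
  obtain \<eta> where \<eta>: "\<And>n. smooth1 (\<eta> n)" "\<And>n. supported_in 0 1 (\<eta> n)"
    "\<And>n x. 0 \<le> \<eta> n x" "\<And>n x. \<eta> n x \<le> 1" "\<And>x. (\<lambda>n. \<eta> n x) \<longlonglongrightarrow> indicator {0<..<1} x"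
    using smooth_approx_indicator[of 0 1] by blast
  have b\<eta>: "bounded_on_unit (\<eta> n) 1" for n
    using \<eta> by (simp add: bounded_on_unit_def)
  have lim\<eta>: "(\<lambda>n. \<eta> n x * c x) \<longlonglongrightarrow> c x" if "x \<in> {0<..<1}" for x and c :: "real \<Rightarrow> real"
    using tendsto_mult[OF \<eta>(5)[of x] tendsto_const[of "c x"]] that by simp
  note int = L2_integrable[OF g1(2)] L2_integrable[OF g2(2)] L2_integrable[OF G(2)]
  note meas = smooth1_measurable
  \<comment> \<open>both factors compactly supported\<close>
  have test: "(\<integral>x. g2 x * tensor (deriv p) q x \<partial>square_measure) = - (\<integral>x. G x * tensor p q x \<partial>square_measure)"
    if p: "smooth1 p" "supported_in 0 1 p" and q: "smooth1 q" "supported_in 0 1 q" for p q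
  proof -
    have "(\<integral>x. f x * tensor (deriv p) (deriv q) x \<partial>square_measure) = (\<integral>x. G x * tensor p q x \<partial>square_measure)"
      using G(1) tensor_test_function[OF p(1) q(1) p(2) q(2)] p(1) q(1)
      by (auto simp: has_weak_deriv_def partial_tensor smooth1_deriv dest!: bspec)
    then show ?thesis
      using H10_by_parts_tensor(2)[OF f smooth1_deriv[OF p(1)] q(1) g2] by simp
  qed
  \<comment> \<open>only the factor in the first variable compactly supported\<close>
  have half: "(\<integral>x. g1 x * tensor p (deriv b) x \<partial>square_measure) = - (\<integral>x. G x * tensor p b x \<partial>square_measure)"
    if p: "smooth1 p" "supported_in 0 1 p" for p
  proof -
    obtain B where B: "bounded_on_unit b B"
      using smooth1_bounded_on_unit[OF b] by blast
    obtain P where P: "bounded_on_unit p P"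
      using smooth1_bounded_on_unit[OF p(1)] by blast
    obtain P' where P': "bounded_on_unit (deriv p) P'"
      using smooth1_bounded_on_unit[OF smooth1_deriv[OF p(1)]] by blast
    have "(\<lambda>n. \<integral>x. g2 x * tensor (deriv p) (\<lambda>x. \<eta> n x * b x) x \<partial>square_measure)
        \<longlonglongrightarrow> (\<integral>x. g2 x * tensor (deriv p) b x \<partial>square_measure)"
      by (intro tensor_limit[where C = P' and D = "1 * B"] int tendsto_const lim\<eta> bounded_on_unit_mult[OF b\<eta> B] P' meas
          smooth1_mult \<eta> b p smooth1_deriv)
    moreover have "(\<lambda>n. \<integral>x. G x * tensor p (\<lambda>x. \<eta> n x * b x) x \<partial>square_measure)
        \<longlonglongrightarrow> (\<integral>x. G x * tensor p b x \<partial>square_measure)"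
      by (intro tensor_limit[where C = P and D = "1 * B"] int tendsto_const lim\<eta> bounded_on_unit_mult[OF b\<eta> B] P meas
          smooth1_mult \<eta> b p smooth1_deriv)
    moreover have "(\<integral>x. g2 x * tensor (deriv p) (\<lambda>x. \<eta> n x * b x) x \<partial>square_measure) =
        - (\<integral>x. G x * tensor p (\<lambda>x. \<eta> n x * b x) x \<partial>square_measure)" for n
      by (intro test p smooth1_mult \<eta> b supported_in_mult)
    ultimately have "(\<integral>x. g2 x * tensor (deriv p) b x \<partial>square_measure) = - (\<integral>x. G x * tensor p b x \<partial>square_measure)"
      by (rule limits_negated)
    then show ?thesis
      using H10_by_parts_tensor(2)[OF f smooth1_deriv[OF p(1)] b g2]
        H10_by_parts_tensor(1)[OF f p(1) smooth1_deriv[OF b] g1] by simp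
  qed
  obtain A where A: "bounded_on_unit a A"
    using smooth1_bounded_on_unit[OF a] by blast
  obtain B where B: "bounded_on_unit b B"
    using smooth1_bounded_on_unit[OF b] by blast
  obtain B' where B': "bounded_on_unit (deriv b) B'"
    using smooth1_bounded_on_unit[OF smooth1_deriv[OF b]] by blast
  have "(\<lambda>n. \<integral>x. g1 x * tensor (\<lambda>x. \<eta> n x * a x) (deriv b) x \<partial>square_measure)
      \<longlonglongrightarrow> (\<integral>x. g1 x * tensor a (deriv b) x \<partial>square_measure)"
    by (intro tensor_limit[where C = "1 * A" and D = B'] int tendsto_const lim\<eta> bounded_on_unit_mult[OF b\<eta> A] B' meas
        smooth1_mult \<eta> a b smooth1_deriv)
  moreover have "(\<lambda>n. \<integral>x. G x * tensor (\<lambda>x. \<eta> n x * a x) b x \<partial>square_measure)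
      \<longlonglongrightarrow> (\<integral>x. G x * tensor a b x \<partial>square_measure)"
    by (intro tensor_limit[where C = "1 * A" and D = B] int tendsto_const lim\<eta> bounded_on_unit_mult[OF b\<eta> A] B meas
        smooth1_mult \<eta> a b smooth1_deriv)
  moreover have "(\<integral>x. g1 x * tensor (\<lambda>x. \<eta> n x * a x) (deriv b) x \<partial>square_measure) =
      - (\<integral>x. G x * tensor (\<lambda>x. \<eta> n x * a x) b x \<partial>square_measure)" for n
    by (intro half a smooth1_mult \<eta> supported_in_mult)
  ultimately show ?thesis
    by (rule limits_negated)
qed

section \<open>Passing to indicator functions\<close>

text \<open>
  The length of \<open>{c<..<d} \<inter> {y<..}\<close>: up to sign the primitive, vanishing at 1, of the indicator of
  \<open>{c<..<d}\<close> for \<open>d \<le> 1\<close>.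
\<close>

definition tail_length :: "real \<Rightarrow> real \<Rightarrow> real \<Rightarrow> real" where
  "tail_length c d y = max 0 (d - max c y)"

lemma tail_length_measurable: "tail_length c d \<in> borel_measurable borel"
  unfolding tail_length_def by (intro borel_measurable_continuous_onI continuous_intros)

text \<open>
  The antiderivatives vanishing at 1 of the smooth approximations to the indicator; they converge
  together with their derivatives, so both sides of an integration by parts have a limit.
\<close>

lemma smooth_primitive_of_indicator:
  fixes c d :: real
  assumes d: "d \<le> 1"
  obtains b :: "nat \<Rightarrow> real \<Rightarrow> real" where "\<And>n. smooth1 (b n)" "\<And>n. bounded_on_unit (b n) 1"
    "\<And>x. x \<in> {0<..<1} \<Longrightarrow> (\<lambda>n. b n x) \<longlonglongrightarrow> - tail_length c d x"
    "\<And>n. bounded_on_unit (deriv (b n)) 1" "\<And>x. (\<lambda>n. deriv (b n) x) \<longlonglongrightarrow> indicator {c<..<d} x"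
proof -
  obtain \<eta> where \<eta>: "\<And>n. smooth1 (\<eta> n)" "\<And>n. supported_in c d (\<eta> n)"
    "\<And>n x. 0 \<le> \<eta> n x" "\<And>n x. \<eta> n x \<le> 1" "\<And>x. (\<lambda>n. \<eta> n x) \<longlonglongrightarrow> indicator {c<..<d} x"
    using smooth_approx_indicator[of c d] by blast
  have "\<exists>F. smooth1 F \<and> deriv F = \<eta> n" for n
    using smooth1_has_antiderivative[OF \<eta>(1)[of n]] by blast
  then obtain F where F: "\<And>n. smooth1 (F n)" "\<And>n. deriv (F n) = \<eta> n"
    by metis
  define b where "b n x = F n x + (- F n 1)" for n x
  have b: "smooth1 (b n)" for n
    unfolding b_def by (intro smooth1_add smooth1_const F)
  have Db: "(b n has_real_derivative \<eta> n x) (at x)" for n x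
    unfolding b_def using smooth1_has_derivative[OF F(1)[of n], of x] F(2)
    by (auto intro!: derivative_eq_intros)
  have b1: "b n 1 = 0" for n
    by (simp add: b_def)
  show thesis
  proof (rule that[of b])
    have deriv_b: "deriv (b n) = \<eta> n" for n
      by (intro ext DERIV_imp_deriv Db)
    show "bounded_on_unit (deriv (b n)) 1" "(\<lambda>n. deriv (b n) x) \<longlonglongrightarrow> indicator {c<..<d} x" for n x
      using \<eta> by (auto simp: deriv_b bounded_on_unit_def)
    show "bounded_on_unit (b n) 1" for n
      unfolding bounded_on_unit_def
    proof
      fix x :: real assume x: "x \<in> {0<..<1}"
      then obtain z where "b n 1 - b n x = (1 - x) * \<eta> n z"
        using MVT2[of x 1 "b n" "\<eta> n"] Db by auto
      then have "- b n x = (1 - x) * \<eta> n z"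
        using b1 by simp
      moreover have "0 \<le> (1 - x) * \<eta> n z" "(1 - x) * \<eta> n z \<le> 1"
        using x \<eta>(3,4)[of n z] by (auto intro!: mult_nonneg_nonneg mult_le_one)
      ultimately show "\<bar>b n x\<bar> \<le> 1"
        by linarith
    qed
    fix x :: real assume x: "x \<in> {0<..<1}"
    have int: "(\<eta> n has_integral - b n x) {x..1}" for n
    proof -
      have "(\<eta> n has_integral b n 1 - b n x) {x..1}"
        using x Db by (intro fundamental_theorem_of_calculus)
          (auto simp: has_real_derivative_iff_has_vector_derivative[symmetric] intro: has_field_derivative_at_within)
      then show ?thesis
        by (simp add: b1)
    qed
    have "(\<lambda>n. integral {x..1} (\<eta> n)) \<longlonglongrightarrow> integral {x..1} (indicator {c<..<d} :: real \<Rightarrow> real)"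
    proof (rule dominated_convergence(2))
      show "\<eta> n integrable_on {x..1}" for n
        using int by blast
      show "(\<lambda>x. 1 :: real) integrable_on {x..1}"
        by (rule integrable_const_ivl)
    qed (use \<eta> in auto)
    moreover have "integral {x..1} (indicator {c<..<d} :: real \<Rightarrow> real) = tail_length c d x"
    proof -
      have eq: "{c<..<d} \<inter> {x<..<1} = {max c x<..<d}"
        using d by auto
      have "integral {x..1} (indicator {c<..<d} :: real \<Rightarrow> real) = integral {x<..<1} (indicator {c<..<d})"
        by (rule integral_open_interval_real)
      also have "\<dots> = measure lebesgue ({c<..<d} \<inter> {x<..<1})"
        by (rule integral_indicator) (simp add: eq)
      also have "\<dots> = tail_length c d x"
        unfolding eq by (cases "max c x \<le> d") (auto simp: tail_length_def le_max_iff_disj)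
      finally show ?thesis .
    qed
    ultimately have "(\<lambda>n. - b n x) \<longlonglongrightarrow> tail_length c d x"
      using integral_unique[OF int] by simp
    then show "(\<lambda>n. b n x) \<longlonglongrightarrow> - tail_length c d x"
      using tendsto_minus by fastforce
  qed (rule b)
qed

lemma tensor_uminus: "tensor a (\<lambda>x. - b x) = (\<lambda>x. - tensor a b x)" "tensor (\<lambda>x. - a x) b = (\<lambda>x. - tensor a b x)"
  by (auto simp: tensor_def)

lemma bounded_indicator: "bounded_on_unit (indicator A) 1" "bounded_on_unit (\<lambda>x. 1) 1"
  by (auto simp: bounded_on_unit_def indicator_def)

text \<open>
  A function with zero boundary values together with square-integrable representatives of its first
  derivatives and of its mixed derivative.
\<close>

locale H10_mixed =
  fixes f g1 g2 G :: "real \<times> real \<Rightarrow> real"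
  assumes f: "f \<in> sobolev_H10 unit_square"
    and g1: "has_weak_deriv unit_square [e1] f g1" "g1 \<in> L2_space unit_square"
    and g2: "has_weak_deriv unit_square [e2] f g2" "g2 \<in> L2_space unit_square"
    and G: "has_weak_deriv unit_square [e1, e2] f G" "G \<in> L2_space unit_square"
begin

lemma f_L2: "f \<in> L2_space unit_square"
  using f by (auto simp: sobolev_H10_def sobolev_def)

lemmas ints = L2_integrable[OF g1(2)] L2_integrable[OF G(2)] L2_integrable[OF f_L2]

lemmas mixed = mixed_by_parts[OF f g1 g2 G]

text \<open>
  The statement that \<open>g1\<close> is the integral of \<open>G\<close> over the second variable starting from the edge at 0,
  averaged over a rectangle and therefore free of sections and exceptional null sets.
\<close>

lemma strip_identity_smooth:
  assumes a: "smooth1 a" and d: "d \<le> 1"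
  shows "(\<integral>x. g1 x * tensor a (indicator {c<..<d}) x \<partial>square_measure) =
    (\<integral>x. G x * tensor a (tail_length c d) x \<partial>square_measure)"
proof -
  obtain b where b: "\<And>n. smooth1 (b n)" "\<And>n. bounded_on_unit (b n) 1"
    "\<And>x. x \<in> {0<..<1} \<Longrightarrow> (\<lambda>n. b n x) \<longlonglongrightarrow> - tail_length c d x"
    "\<And>n. bounded_on_unit (deriv (b n)) 1" "\<And>x. (\<lambda>n. deriv (b n) x) \<longlonglongrightarrow> indicator {c<..<d} x"
    using smooth_primitive_of_indicator[OF d] by metis
  obtain A where A: "bounded_on_unit a A"
    using smooth1_bounded_on_unit[OF a] by blast
  have "(\<lambda>n. \<integral>x. g1 x * tensor a (deriv (b n)) x \<partial>square_measure) \<longlonglongrightarrow>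
      (\<integral>x. g1 x * tensor a (indicator {c<..<d}) x \<partial>square_measure)"
    by (intro tensor_limit[where C = A and D = 1] ints a A b tendsto_const smooth1_measurable smooth1_deriv
        indicator_Ioo_measurable)
  moreover have "(\<lambda>n. \<integral>x. G x * tensor a (b n) x \<partial>square_measure) \<longlonglongrightarrow>
      (\<integral>x. G x * tensor a (\<lambda>x. - tail_length c d x) x \<partial>square_measure)"
    by (intro tensor_limit[where C = A and D = 1] ints a A b tendsto_const smooth1_measurable
        borel_measurable_uminus tail_length_measurable)
  moreover have "(\<integral>x. g1 x * tensor a (deriv (b n)) x \<partial>square_measure) = - (\<integral>x. G x * tensor a (b n) x \<partial>square_measure)" for n
    by (rule mixed[OF a b(1)])
  ultimately have "(\<integral>x. g1 x * tensor a (indicator {c<..<d}) x \<partial>square_measure) =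
      - (\<integral>x. G x * tensor a (\<lambda>x. - tail_length c d x) x \<partial>square_measure)"
    by (rule limits_negated)
  then show ?thesis
    by (simp add: tensor_uminus)
qed

lemma tail_length_bounded: "d \<le> 1 \<Longrightarrow> bounded_on_unit (tail_length c d) 1"
  by (auto simp: bounded_on_unit_def tail_length_def)

lemma strip_identity:
  assumes d: "d \<le> 1"
  shows "(\<integral>x. g1 x * tensor (indicator {p<..<q}) (indicator {c<..<d}) x \<partial>square_measure) =
    (\<integral>x. G x * tensor (indicator {p<..<q}) (tail_length c d) x \<partial>square_measure)"
proof -
  obtain \<eta> where \<eta>: "\<And>n. smooth1 (\<eta> n)" "\<And>n. supported_in p q (\<eta> n)"
    "\<And>n x. 0 \<le> \<eta> n x" "\<And>n x. \<eta> n x \<le> 1" "\<And>x. (\<lambda>n. \<eta> n x) \<longlonglongrightarrow> indicator {p<..<q} x"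
    using smooth_approx_indicator[of p q] by blast
  have b\<eta>: "bounded_on_unit (\<eta> n) 1" for n
    using \<eta> by (simp add: bounded_on_unit_def)
  have "(\<lambda>n. \<integral>x. g1 x * tensor (\<eta> n) (indicator {c<..<d}) x \<partial>square_measure) \<longlonglongrightarrow>
      (\<integral>x. g1 x * tensor (indicator {p<..<q}) (indicator {c<..<d}) x \<partial>square_measure)"
    by (intro tensor_limit[where C = 1 and D = 1] ints \<eta> b\<eta> tendsto_const smooth1_measurable
        indicator_Ioo_measurable bounded_indicator)
  moreover have "(\<lambda>n. \<integral>x. g1 x * tensor (\<eta> n) (indicator {c<..<d}) x \<partial>square_measure) \<longlonglongrightarrow>
      (\<integral>x. G x * tensor (indicator {p<..<q}) (tail_length c d) x \<partial>square_measure)"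
    unfolding strip_identity_smooth[OF \<eta>(1) d]
    by (intro tensor_limit[where C = 1 and D = 1] ints \<eta> b\<eta> tendsto_const smooth1_measurable
        indicator_Ioo_measurable tail_length_bounded d tail_length_measurable)
  ultimately show ?thesis
    by (rule LIMSEQ_unique)
qed

text \<open>
  The twice integrated form: \<open>f\<close> is the double integral of \<open>G\<close>, tested on rectangles.
\<close>

lemma rectangle_identity:
  assumes q: "q \<le> 1" and d: "d \<le> 1"
  shows "(\<integral>x. f x * tensor (indicator {p<..<q}) (indicator {c<..<d}) x \<partial>square_measure) =
    (\<integral>x. G x * tensor (tail_length p q) (tail_length c d) x \<partial>square_measure)"
proof -
  obtain a where a: "\<And>n. smooth1 (a n)" "\<And>n. bounded_on_unit (a n) 1"
    "\<And>x. x \<in> {0<..<1} \<Longrightarrow> (\<lambda>n. a n x) \<longlonglongrightarrow> - tail_length p q x"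
    "\<And>n. bounded_on_unit (deriv (a n)) 1" "\<And>x. (\<lambda>n. deriv (a n) x) \<longlonglongrightarrow> indicator {p<..<q} x"
    using smooth_primitive_of_indicator[OF q] by metis
  obtain b where b: "\<And>n. smooth1 (b n)" "\<And>n. bounded_on_unit (b n) 1"
    "\<And>x. x \<in> {0<..<1} \<Longrightarrow> (\<lambda>n. b n x) \<longlonglongrightarrow> - tail_length c d x"
    "\<And>n. bounded_on_unit (deriv (b n)) 1" "\<And>x. (\<lambda>n. deriv (b n) x) \<longlonglongrightarrow> indicator {c<..<d} x"
    using smooth_primitive_of_indicator[OF d] by metis
  have eq: "(\<integral>x. f x * tensor (deriv (a n)) (deriv (b n)) x \<partial>square_measure) =
      (\<integral>x. G x * tensor (a n) (b n) x \<partial>square_measure)" for n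
    using H10_by_parts_tensor(1)[OF f a(1)[of n] smooth1_deriv[OF b(1)[of n]] g1] mixed[OF a(1)[of n] b(1)[of n]]
    by simp
  have "(\<lambda>n. \<integral>x. f x * tensor (deriv (a n)) (deriv (b n)) x \<partial>square_measure) \<longlonglongrightarrow>
      (\<integral>x. f x * tensor (indicator {p<..<q}) (indicator {c<..<d}) x \<partial>square_measure)"
    by (intro tensor_limit[where C = 1 and D = 1] ints a b tendsto_const smooth1_measurable smooth1_deriv
        indicator_Ioo_measurable)
  moreover have "(\<lambda>n. \<integral>x. f x * tensor (deriv (a n)) (deriv (b n)) x \<partial>square_measure) \<longlonglongrightarrow>
      (\<integral>x. G x * tensor (\<lambda>x. - tail_length p q x) (\<lambda>x. - tail_length c d x) x \<partial>square_measure)"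
    unfolding eq
    by (intro tensor_limit[where C = 1 and D = 1] ints a b tendsto_const smooth1_measurable
        borel_measurable_uminus tail_length_measurable)
  ultimately show ?thesis
    using LIMSEQ_unique by (fastforce simp: tensor_uminus)
qed

text \<open>
  Full horizontal strips carry no mass of \<open>G\<close>: the test function constant in the first variable has
  derivative zero. The identity expresses that \<open>f\<close> vanishes on the right edge as well as on the left one, and it is
  the source of the factor one half in the final bound.
\<close>

lemma mixed_integral_over_strip:
  "(\<integral>x. G x * tensor (\<lambda>x. 1) (indicator {c<..<d}) x \<partial>square_measure) = 0"
proof -
  obtain \<eta> where \<eta>: "\<And>n. smooth1 (\<eta> n)" "\<And>n. supported_in c d (\<eta> n)"
    "\<And>n x. 0 \<le> \<eta> n x" "\<And>n x. \<eta> n x \<le> 1" "\<And>x. (\<lambda>n. \<eta> n x) \<longlonglongrightarrow> indicator {c<..<d} x"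
    using smooth_approx_indicator[of c d] by blast
  have b\<eta>: "bounded_on_unit (\<eta> n) 1" for n
    using \<eta> by (simp add: bounded_on_unit_def)
  have "(\<lambda>n. \<integral>x. G x * tensor (\<lambda>x. 1) (\<eta> n) x \<partial>square_measure) \<longlonglongrightarrow>
      (\<integral>x. G x * tensor (\<lambda>x. 1) (indicator {c<..<d}) x \<partial>square_measure)"
    by (intro tensor_limit[where C = 1 and D = 1] ints \<eta> b\<eta> tendsto_const smooth1_measurable
        indicator_Ioo_measurable bounded_indicator smooth1_const)
  moreover have zero: "(\<integral>x. G x * tensor (\<lambda>x. 1) (\<eta> n) x \<partial>square_measure) = 0" for n
    using mixed[OF smooth1_const[of 1] \<eta>(1)[of n]]
      H10_by_parts_tensor(1)[OF f smooth1_const[of 1] smooth1_deriv[OF \<eta>(1)[of n]] g1]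
    by (simp add: tensor_def)
  ultimately show ?thesis
    by (simp add: LIMSEQ_const_iff)
qed

end

section \<open>The continuous representative\<close>

lemma AE_square_fst_neq: "AE x in square_measure. fst x \<noteq> c"
  and AE_square_snd_neq: "AE x in square_measure. snd x \<noteq> c"
proof -
  have "AE x in lebesgue. x \<bullet> i \<noteq> c" if "i \<in> Basis" for i :: "real \<times> real"
    using negligible_standard_hyperplane[OF that, of c] AE_not_in[of "{x. x \<bullet> i = c}" lebesgue]
    by (simp add: negligible_iff_null_sets)
  from this[of e1] this[of e2] show "AE x in square_measure. fst x \<noteq> c" "AE x in square_measure. snd x \<noteq> c"
    by (auto simp: AE_restrict_space_iff Basis_plane inner_prod_def elim: eventually_mono)
qed

text \<open>
  The candidate for the continuous representative: the double integral of \<open>G\<close> from the corner at the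
  origin.
\<close>

definition corner_integral :: "(real \<times> real \<Rightarrow> real) \<Rightarrow> real \<times> real \<Rightarrow> real" where
  "corner_integral G x =
     (\<integral>y. G y * tensor (indicator {0<..<fst x}) (indicator {0<..<snd x}) y \<partial>square_measure)"

text \<open>
  Moving \<open>x\<close> changes the indicators only near two lines, and lines are null sets.
\<close>

lemma continuous_corner_integral:
  assumes G: "integrable square_measure G"
  shows "continuous_on UNIV (corner_integral G)"
  unfolding continuous_on_sequentially
proof (intro allI ballI impI, elim conjE)
  fix X :: "nat \<Rightarrow> real \<times> real" and x
  assume X: "X \<longlonglongrightarrow> x"
  have ind: "(\<lambda>n. indicator {0<..<Z n} y :: real) \<longlonglongrightarrow> indicator {0<..<z} y"
    if "Z \<longlonglongrightarrow> z" "y \<noteq> z" for Z and y z :: real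
  proof (rule tendsto_eventually)
    consider "y < z" | "z < y" using \<open>y \<noteq> z\<close> by linarith
    then show "eventually (\<lambda>n. indicator {0<..<Z n} y = (indicator {0<..<z} y :: real)) sequentially"
    proof cases
      case 1
      from order_tendstoD(1)[OF \<open>Z \<longlonglongrightarrow> z\<close> 1] show ?thesis
        by eventually_elim (use 1 in \<open>auto simp: indicator_def\<close>)
    next
      case 2
      from order_tendstoD(2)[OF \<open>Z \<longlonglongrightarrow> z\<close> 2] show ?thesis
        by eventually_elim (use 2 in \<open>auto simp: indicator_def\<close>)
    qed
  qed
  have "(\<lambda>n. corner_integral G (X n)) \<longlonglongrightarrow> corner_integral G x"
    unfolding corner_integral_def
  proof (rule integral_dominated_convergence)
    show "(\<lambda>y. G y * tensor (indicator {0<..<fst x}) (indicator {0<..<snd x}) y) \<in> borel_measurable square_measure" for x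
      using G by (intro square_times_tensor_measurable indicator_Ioo_measurable) auto
    then show "(\<lambda>y. G y * tensor (indicator {0<..<fst (X n)}) (indicator {0<..<snd (X n)}) y)
        \<in> borel_measurable square_measure" for n .
    show "integrable square_measure (\<lambda>y. \<bar>G y\<bar>)"
      using G by (rule integrable_abs)
    show "AE y in square_measure. norm (G y * tensor (indicator {0<..<fst (X n)}) (indicator {0<..<snd (X n)}) y) \<le> \<bar>G y\<bar>" for n
      by (intro AE_I2) (auto simp: tensor_def indicator_def)
    show "AE y in square_measure. (\<lambda>n. G y * tensor (indicator {0<..<fst (X n)}) (indicator {0<..<snd (X n)}) y)
        \<longlonglongrightarrow> G y * tensor (indicator {0<..<fst x}) (indicator {0<..<snd x}) y"
      using AE_square_fst_neq[of "fst x"] AE_square_snd_neq[of "snd x"]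
    proof eventually_elim
      case (elim y)
      then show ?case
        unfolding tensor_def by (intro tendsto_intros ind X)
    qed
  qed
  then show "(corner_integral G \<circ> X) \<longlonglongrightarrow> corner_integral G x"
    by (simp add: comp_def)
qed

lemma measure_square_rectangle:
  assumes "0 \<le> p" "q \<le> 1" "0 \<le> r" "s \<le> 1"
  shows "(\<integral>x. tensor (indicator {p<..<q}) (indicator {r<..<s}) x \<partial>square_measure) = max 0 (q - p) * max 0 (s - r)"
proof -
  have sub: "{p<..<q} \<times> {r<..<s} \<subseteq> unit_square"
    using assms by (auto simp: unit_square_def)
  have box: "{p<..<q} \<times> {r<..<s} = box (p, r) (q, s)"
    by (simp add: box_prod)
  have "(\<integral>x. tensor (indicator {p<..<q}) (indicator {r<..<s}) x \<partial>square_measure)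
      = (\<integral>x. indicator ({p<..<q} \<times> {r<..<s}) x \<partial>square_measure)"
    by (intro Bochner_Integration.integral_cong) (auto simp: tensor_def indicator_def)
  also have "\<dots> = measure lebesgue ({p<..<q} \<times> {r<..<s})"
    using sub by (simp add: measure_restrict_space inf.absorb1)
  also have "\<dots> = max 0 (q - p) * max 0 (s - r)"
    unfolding box by (auto simp: measure_lborel_box_eq Basis_plane inner_prod_def)
  finally show ?thesis .
qed

interpretation square_pair: pair_sigma_finite square_measure square_measure ..

text \<open>
  Fubini: a point \<open>y\<close> is counted by those \<open>x\<close> in the rectangle that lie above and to the right of it.
\<close>

lemma corner_integral_over_rectangle:
  assumes G: "integrable square_measure G" and q: "q \<le> 1" and d: "d \<le> 1"
  shows "(\<integral>x. corner_integral G x * tensor (indicator {p<..<q}) (indicator {c<..<d}) x \<partial>square_measure) =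
    (\<integral>x. G x * tensor (tail_length p q) (tail_length c d) x \<partial>square_measure)"
proof -
  define R where "R = tensor (indicator {p<..<q}) (indicator {c<..<d})"
  define T where "T y x = (indicator {0<..} (fst x - fst y) * indicator {0<..} (snd x - snd y) :: real)"
    for x y :: "real \<times> real"
  have R01: "0 \<le> R x" "R x \<le> 1" for x
    by (auto simp: R_def tensor_def indicator_def)
  have T01: "0 \<le> T y x" "T y x \<le> 1" for x y
    by (auto simp: T_def indicator_def)
  have Rm: "R \<in> borel_measurable square_measure"
    unfolding R_def by (intro measurable_square tensor_measurable indicator_Ioo_measurable)
  have Gm: "G \<in> borel_measurable square_measure"
    using G by auto
  have fm: "fst \<in> borel_measurable square_measure" "snd \<in> borel_measurable square_measure"
    by (intro measurable_square; simp add: borel_prod[symmetric])+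
  have heaviside: "(indicator {0<..} :: real \<Rightarrow> real) \<in> borel_measurable borel"
    by simp
  note fsts = measurable_compose[OF measurable_fst fm(1)] measurable_compose[OF measurable_fst fm(2)]
    measurable_compose[OF measurable_snd fm(1)] measurable_compose[OF measurable_snd fm(2)]
  have m: "(\<lambda>z. G (snd z) * T (snd z) (fst z) * R (fst z)) \<in>
      borel_measurable (square_measure \<Otimes>\<^sub>M square_measure)"
    unfolding T_def
    by (intro borel_measurable_times measurable_compose[OF measurable_snd Gm] measurable_compose[OF measurable_fst Rm]
        measurable_compose[OF _ heaviside] borel_measurable_diff fsts)
  have inner: "integrable square_measure (\<lambda>y. G y * T y x * R x)" for x
  proof (rule Bochner_Integration.integrable_bound[OF G])
    have "(\<lambda>y. T y x) \<in> borel_measurable square_measure"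
      unfolding T_def
      by (intro borel_measurable_times measurable_compose[OF _ heaviside] borel_measurable_diff borel_measurable_const fm)
    then show "(\<lambda>y. G y * T y x * R x) \<in> borel_measurable square_measure"
      by (intro borel_measurable_times Gm borel_measurable_const)
    have "\<bar>T y x * R x\<bar> \<le> 1" for y
      using T01[of y x] R01[of x] by (auto simp: abs_mult intro: mult_le_one)
    then show "AE y in square_measure. norm (G y * T y x * R x) \<le> norm (G y)"
      by (intro AE_I2) (simp add: abs_mult mult.assoc mult_left_le)
  qed
  have int: "integrable (square_measure \<Otimes>\<^sub>M square_measure) (\<lambda>z. G (snd z) * T (snd z) (fst z) * R (fst z))"
  proof (rule square_pair.Fubini_integrable[OF m])
    show "AE x in square_measure. integrable square_measure
        (\<lambda>y. G (snd (x, y)) * T (snd (x, y)) (fst (x, y)) * R (fst (x, y)))"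
      using inner by simp
    show "integrable square_measure (\<lambda>x. \<integral>y. norm (G (snd (x, y)) * T (snd (x, y)) (fst (x, y)) * R (fst (x, y))) \<partial>square_measure)"
    proof (rule Bochner_Integration.integrable_bound)
      show "integrable square_measure (\<lambda>x. \<integral>y. \<bar>G y\<bar> \<partial>square_measure)"
        by simp
      show "(\<lambda>x. \<integral>y. norm (G (snd (x, y)) * T (snd (x, y)) (fst (x, y)) * R (fst (x, y))) \<partial>square_measure)
          \<in> borel_measurable square_measure"
        using square.borel_measurable_lebesgue_integral[of "\<lambda>x y. norm (G y * T y x * R x)" square_measure]
          measurable_compose[OF m borel_measurable_norm] by (simp add: case_prod_unfold)
      have "(\<integral>y. \<bar>G y * T y x * R x\<bar> \<partial>square_measure) \<le> (\<integral>y. \<bar>G y\<bar> \<partial>square_measure)" for x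
      proof (rule integral_mono)
        have "\<bar>T y x * R x\<bar> \<le> 1" for y
          using T01[of y x] R01[of x] by (auto simp: abs_mult intro: mult_le_one)
        then show "\<bar>G y * T y x * R x\<bar> \<le> \<bar>G y\<bar>" for y
          by (simp add: abs_mult mult.assoc mult_left_le)
      qed (use inner G in \<open>auto intro!: integrable_abs\<close>)
      then show "AE x in square_measure. norm (\<integral>y. norm (G (snd (x, y)) * T (snd (x, y)) (fst (x, y)) * R (fst (x, y))) \<partial>square_measure)
          \<le> norm (\<integral>y. \<bar>G y\<bar> \<partial>square_measure)"
        by (intro AE_I2) simp
    qed
  qed
  have "(\<integral>x. corner_integral G x * R x \<partial>square_measure) =
      (\<integral>x. (\<integral>y. G y * T y x * R x \<partial>square_measure) \<partial>square_measure)"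
  proof (intro Bochner_Integration.integral_cong refl)
    fix x
    have "(\<integral>y. G y * T y x * R x \<partial>square_measure) = (\<integral>y. G y * T y x \<partial>square_measure) * R x"
      by simp
    also have "(\<integral>y. G y * T y x \<partial>square_measure) = corner_integral G x"
      unfolding corner_integral_def
      by (intro Bochner_Integration.integral_cong) (auto simp: T_def tensor_def indicator_def unit_square_def)
    finally show "corner_integral G x * R x = (\<integral>y. G y * T y x * R x \<partial>square_measure)" ..
  qed
  also have "\<dots> = (\<integral>y. (\<integral>x. G y * T y x * R x \<partial>square_measure) \<partial>square_measure)"
    using square_pair.Fubini_integral[of "\<lambda>x y. G y * T y x * R x"] int by (simp add: case_prod_unfold)
  also have "\<dots> = (\<integral>x. G x * tensor (tail_length p q) (tail_length c d) x \<partial>square_measure)"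
  proof (intro Bochner_Integration.integral_cong refl)
    fix y assume "y \<in> space square_measure"
    then have y: "0 < fst y" "0 < snd y"
      by (auto simp: unit_square_def)
    have "(\<integral>x. G y * T y x * R x \<partial>square_measure) = G y * (\<integral>x. T y x * R x \<partial>square_measure)"
      by (simp add: mult.assoc)
    also have "(\<integral>x. T y x * R x \<partial>square_measure) =
        (\<integral>x. tensor (indicator {max p (fst y)<..<q}) (indicator {max c (snd y)<..<d}) x \<partial>square_measure)"
      by (intro Bochner_Integration.integral_cong) (auto simp: T_def R_def tensor_def indicator_def)
    also have "\<dots> = tensor (tail_length p q) (tail_length c d) y"
      using y q d by (subst measure_square_rectangle) (auto simp: tensor_def tail_length_def)
    finally show "(\<integral>x. G y * T y x * R x \<partial>square_measure) = G y * tensor (tail_length p q) (tail_length c d) y" .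
  qed
  finally show ?thesis
    by (simp add: R_def)
qed

context H10_mixed
begin

text \<open>
  Both functions have the same integrals over rectangles. An upper bound beyond 1 is cut off there,
  where \<open>tail_length\<close> is the right primitive.
\<close>

lemma corner_integral_eq: "AE x in square_measure. corner_integral G x = f x"
proof -
  have u: "integrable square_measure (corner_integral G)"
    by (intro integrable_square_continuous continuous_corner_integral ints)
  have "AE x in square_measure. corner_integral G x - f x = 0"
  proof (rule AE_zero_if_rectangle_integrals_zero)
    show "integrable square_measure (\<lambda>x. corner_integral G x - f x)"
      using u ints by auto
    fix p q r s :: real
    define R where "R = tensor (indicator {p<..<min q 1}) (indicator {r<..<min s 1})"
    have "(\<integral>x. (corner_integral G x - f x) * tensor (indicator {p<..<q}) (indicator {r<..<s}) x \<partial>square_measure)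
        = (\<integral>x. corner_integral G x * R x - f x * R x \<partial>square_measure)"
      by (intro Bochner_Integration.integral_cong)
        (auto simp: R_def tensor_def indicator_def unit_square_def)
    also have "\<dots> = (\<integral>x. corner_integral G x * R x \<partial>square_measure) - (\<integral>x. f x * R x \<partial>square_measure)"
      unfolding R_def
      by (intro Bochner_Integration.integral_diff integrable_times_tensor[where C = 1 and D = 1] u ints
          indicator_Ioo_measurable bounded_indicator)
    also have "\<dots> = 0"
      unfolding R_def using ints by (simp add: corner_integral_over_rectangle rectangle_identity)
    finally show "(\<integral>x. (corner_integral G x - f x) * tensor (indicator {p<..<q}) (indicator {r<..<s}) x \<partial>square_measure) = 0" .
  qed
  then show ?thesis
    by eventually_elim simp
qed

end

section \<open>The pointwise bound\<close>

lemma L2_scaled_abs: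
  assumes "f \<in> L2_space \<Omega>"
  shows "(\<lambda>x. c * \<bar>f x\<bar>) \<in> L2_space \<Omega>"
proof -
  have "(\<lambda>x. c * \<bar>f x\<bar>) \<in> borel_measurable (lebesgue_on \<Omega>)"
    by (intro borel_measurable_times borel_measurable_const borel_measurable_abs L2_measurable assms)
  moreover have "integrable (lebesgue_on \<Omega>) (\<lambda>x. (c * \<bar>f x\<bar>)\<^sup>2)"
    unfolding power_mult_distrib power2_abs by (intro integrable_mult_right L2_square_integrable assms)
  ultimately show ?thesis
    unfolding L2_space_def by blast
qed

context H10_mixed
begin

text \<open>
  Let \<open>U\<close> be the integral of \<open>G\<close> below height \<open>y\<close>, weighted by \<open>a\<close>. The strip identity turns \<open>\<delta> U\<close>, up to
  an integral of \<open>g1\<close> over the strip, into an integral of \<open>G\<close> against the kernel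
  \<open>\<delta> 1\<^bsub>(0,y)\<^esub> - tail_length c (c + \<delta>)\<close>. This kernel vanishes off the strip and is at most \<open>\<delta>\<close> on it. The
  reason is that the strip either ends at height \<open>y\<close>, or starts at the bottom edge and reaches at least to
  height \<open>y\<close>.
\<close>

lemma weighted_strip_bound:
  assumes a: "a \<in> borel_measurable borel" "\<And>x. 0 \<le> a x" "\<And>x. a x \<le> 1"
    and c: "0 \<le> c" "c + \<delta> \<le> 1" and \<delta>: "0 < \<delta>" and y: "y \<le> c + \<delta>" "c > 0 \<Longrightarrow> y = c + \<delta>"
    and strip: "(\<integral>x. g1 x * tensor a (indicator {c<..<c + \<delta>}) x \<partial>square_measure) =
      (\<integral>x. G x * tensor a (tail_length c (c + \<delta>)) x \<partial>square_measure)"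
  shows "\<delta> * \<bar>\<integral>x. G x * tensor a (indicator {0<..<y}) x \<partial>square_measure\<bar>
    \<le> (\<integral>x. (\<bar>g1 x\<bar> + \<delta> * \<bar>G x\<bar>) * tensor a (indicator {c<..<c + \<delta>}) x \<partial>square_measure)"
proof -
  have ab: "bounded_on_unit a 1"
    using a by (simp add: bounded_on_unit_def)
  note tI = integrable_times_tensor[where C = 1 and D = 1, OF _ a(1) _ ab]
  have i1: "integrable square_measure (\<lambda>x. g1 x * tensor a (indicator {c<..<c + \<delta>}) x)"
    and i2: "integrable square_measure (\<lambda>x. G x * tensor a (indicator {0<..<y}) x)"
    and i3: "integrable square_measure (\<lambda>x. G x * tensor a (tail_length c (c + \<delta>)) x)"
    by (intro tI ints indicator_Ioo_measurable bounded_indicator tail_length_measurable tail_length_bounded c)+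
  have i4: "integrable square_measure (\<lambda>x. (\<bar>g1 x\<bar> + \<delta> * \<bar>G x\<bar>) * tensor a (indicator {c<..<c + \<delta>}) x)"
    by (intro tI Bochner_Integration.integrable_add integrable_mult_right integrable_abs ints
        indicator_Ioo_measurable bounded_indicator)
  define h where "h x = \<delta> * (G x * tensor a (indicator {0<..<y}) x) -
      G x * tensor a (tail_length c (c + \<delta>)) x + g1 x * tensor a (indicator {c<..<c + \<delta>}) x" for x
  have ih: "integrable square_measure h"
    unfolding h_def by (intro Bochner_Integration.integrable_add Bochner_Integration.integrable_diff integrable_mult_right i1 i2 i3)
  have "(\<integral>x. h x \<partial>square_measure) = \<delta> * (\<integral>x. G x * tensor a (indicator {0<..<y}) x \<partial>square_measure)"
    unfolding h_def using i1 i2 i3 strip by simp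
  then have "\<delta> * \<bar>\<integral>x. G x * tensor a (indicator {0<..<y}) x \<partial>square_measure\<bar> = \<bar>\<integral>x. h x \<partial>square_measure\<bar>"
    using \<delta> by (simp add: abs_mult)
  also have "\<dots> \<le> (\<integral>x. \<bar>h x\<bar> \<partial>square_measure)"
    by (rule integral_abs_bound)
  also have "\<dots> \<le> (\<integral>x. (\<bar>g1 x\<bar> + \<delta> * \<bar>G x\<bar>) * tensor a (indicator {c<..<c + \<delta>}) x \<partial>square_measure)"
  proof (rule integral_mono[OF integrable_abs[OF ih] i4])
    fix x assume "x \<in> space square_measure"
    then obtain s t where x: "x = (s, t)" and t: "0 < t" "t < 1"
      by (cases x) (auto simp: unit_square_def)
    define k where "k = \<delta> * indicator {0<..<y} t - tail_length c (c + \<delta>) t"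
    \<comment> \<open>below the strip both terms are \<open>\<delta>\<close>, above it both are 0\<close>
    have k: "\<bar>k\<bar> \<le> \<delta> * indicator {c<..<c + \<delta>} t"
      using t c \<delta> y by (cases "c > 0") (auto simp: k_def tail_length_def indicator_def)
    have "h x = a s * (G x * k + g1 x * indicator {c<..<c + \<delta>} t)"
      by (simp add: h_def x tensor_def k_def algebra_simps)
    then have "\<bar>h x\<bar> = a s * \<bar>G x * k + g1 x * indicator {c<..<c + \<delta>} t\<bar>"
      using a(2)[of s] by (simp add: abs_mult)
    also have "\<dots> \<le> a s * (\<bar>G x\<bar> * (\<delta> * indicator {c<..<c + \<delta>} t) + \<bar>g1 x\<bar> * indicator {c<..<c + \<delta>} t)"
    proof (rule mult_left_mono[OF _ a(2)])
      have "\<bar>G x * k\<bar> \<le> \<bar>G x\<bar> * (\<delta> * indicator {c<..<c + \<delta>} t)"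
        unfolding abs_mult using k by (rule mult_left_mono) simp
      moreover have "\<bar>g1 x * indicator {c<..<c + \<delta>} t\<bar> = \<bar>g1 x\<bar> * indicator {c<..<c + \<delta>} t"
        by (simp add: abs_mult)
      ultimately show "\<bar>G x * k + g1 x * indicator {c<..<c + \<delta>} t\<bar> \<le>
          \<bar>G x\<bar> * (\<delta> * indicator {c<..<c + \<delta>} t) + \<bar>g1 x\<bar> * indicator {c<..<c + \<delta>} t"
        using abs_triangle_ineq[of "G x * k" "g1 x * indicator {c<..<c + \<delta>} t"] by linarith
    qed
    also have "\<dots> = (\<bar>g1 x\<bar> + \<delta> * \<bar>G x\<bar>) * tensor a (indicator {c<..<c + \<delta>}) x"
      by (simp add: x tensor_def algebra_simps)
    finally show "\<bar>h x\<bar> \<le> (\<bar>g1 x\<bar> + \<delta> * \<bar>G x\<bar>) * tensor a (indicator {c<..<c + \<delta>}) x" .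
  qed
  finally show ?thesis .
qed

text \<open>
  The weights \<open>a = 1\<^bsub>(0,x1)\<^esub>\<close> and \<open>1 - a\<close> give opposite values \<open>u\<close> and \<open>-u\<close>, since their sum integrates to
  zero. Adding the two estimates for \<open>\<bar>u\<bar>\<close> bounds \<open>2 \<delta> \<bar>u\<bar>\<close> by one integral over the full strip, to which
  Cauchy-Schwarz applies with the area \<open>\<delta>\<close> of the strip.
\<close>

lemma corner_integral_strip_bound:
  assumes x: "x \<in> {0..1} \<times> {0..1}" and \<delta>: "0 < \<delta>" "\<delta> \<le> 1"
  shows "(corner_integral G x)\<^sup>2 \<le> ((L2_norm unit_square g1)\<^sup>2 / \<delta> + \<delta> * (L2_norm unit_square G)\<^sup>2) / 2"
proof -
  obtain x1 x2 where x12: "x = (x1, x2)" "0 \<le> x1" "x1 \<le> 1" "0 \<le> x2" "x2 \<le> 1"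
    using x by auto
  \<comment> \<open>the strip of height \<open>\<delta>\<close> just below \<open>x2\<close>, or resting on the bottom edge if that is too close\<close>
  define c where "c = max 0 (x2 - \<delta>)"
  have c: "0 \<le> c" "c + \<delta> \<le> 1" "x2 \<le> c + \<delta>" "c > 0 \<Longrightarrow> x2 = c + \<delta>"
    using x12 \<delta> by (auto simp: c_def)
  define J where "J = {c<..<c + \<delta>}"
  define F where "F x = \<bar>g1 x\<bar> + \<delta> * \<bar>G x\<bar>" for x
  define a where "a = (indicator {0<..<x1} :: real \<Rightarrow> real)"
  define u where "u = corner_integral G x"
  have a: "a \<in> borel_measurable borel" "0 \<le> a s" "a s \<le> 1" for s
    by (auto simp: a_def indicator_def)
  have a': "(\<lambda>s. 1 - a s) \<in> borel_measurable borel" "0 \<le> 1 - a s" "1 - a s \<le> 1" for s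
    using a by auto
  have ab: "bounded_on_unit a 1"
    using a by (auto simp: bounded_on_unit_def)
  have compl: "(\<integral>x. k x * tensor (\<lambda>s. 1 - a s) b x \<partial>square_measure) =
      (\<integral>x. k x * tensor (\<lambda>s. 1) b x \<partial>square_measure) - (\<integral>x. k x * tensor a b x \<partial>square_measure)"
    if k: "integrable square_measure k" and b: "b \<in> borel_measurable borel" "bounded_on_unit b 1" for k b
  proof -
    have "integrable square_measure (\<lambda>x. k x * tensor (\<lambda>s. 1) b x)" "integrable square_measure (\<lambda>x. k x * tensor a b x)"
      by (rule integrable_times_tensor[OF k _ b(1) _ b(2), where C = 1]; simp add: a ab bounded_indicator)+
    then show ?thesis
      by (simp add: tensor_def left_diff_distrib right_diff_distrib)
  qed
  have Jm: "indicator J \<in> borel_measurable (borel :: real measure)"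
    by (simp add: J_def)
  note tm = tail_length_measurable tail_length_bounded[OF c(2)]
  have strip1: "(\<integral>x. g1 x * tensor a (indicator J) x \<partial>square_measure) =
      (\<integral>x. G x * tensor a (tail_length c (c + \<delta>)) x \<partial>square_measure)"
    unfolding a_def J_def by (rule strip_identity[OF c(2)])
  have "(\<integral>x. g1 x * tensor (\<lambda>s. 1) (indicator J) x \<partial>square_measure) =
      (\<integral>x. G x * tensor (\<lambda>s. 1) (tail_length c (c + \<delta>)) x \<partial>square_measure)"
    unfolding J_def by (rule strip_identity_smooth[OF smooth1_const c(2)])
  with strip1 have strip2: "(\<integral>x. g1 x * tensor (\<lambda>s. 1 - a s) (indicator J) x \<partial>square_measure) =
      (\<integral>x. G x * tensor (\<lambda>s. 1 - a s) (tail_length c (c + \<delta>)) x \<partial>square_measure)"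
    by (simp add: compl[OF ints(1) Jm bounded_indicator(1)] compl[OF ints(2) tm])
  have u1: "u = (\<integral>x. G x * tensor a (indicator {0<..<x2}) x \<partial>square_measure)"
    by (simp add: u_def corner_integral_def x12 a_def)
  have u2: "- u = (\<integral>x. G x * tensor (\<lambda>s. 1 - a s) (indicator {0<..<x2}) x \<partial>square_measure)"
    by (simp add: compl[OF ints(2) indicator_Ioo_measurable bounded_indicator(1)] mixed_integral_over_strip u1)
  have Fi: "integrable square_measure F"
    unfolding F_def by (intro Bochner_Integration.integrable_add integrable_mult_right integrable_abs ints)
  have box: "{0<..<1::real} \<times> J = box (0, c) (1, c + \<delta>)"
    by (simp add: box_prod J_def)
  have sub: "{0<..<1} \<times> J \<subseteq> unit_square"
    using c by (auto simp: unit_square_def J_def)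
  have m: "measure square_measure ({0<..<1} \<times> J) = \<delta>"
    using sub \<delta> by (simp add: measure_restrict_space box measure_lborel_box_eq Basis_plane inner_prod_def)
  have "\<delta> * \<bar>u\<bar> \<le> (\<integral>x. F x * tensor a (indicator J) x \<partial>square_measure)"
    unfolding u1 F_def J_def
    by (rule weighted_strip_bound[OF a c(1,2) \<delta>(1) c(3,4) strip1[unfolded J_def]])
  moreover have "\<delta> * \<bar>- u\<bar> \<le> (\<integral>x. F x * tensor (\<lambda>s. 1 - a s) (indicator J) x \<partial>square_measure)"
    unfolding u2 F_def J_def
    by (rule weighted_strip_bound[OF a' c(1,2) \<delta>(1) c(3,4) strip2[unfolded J_def]])
  ultimately have "2 * \<delta> * \<bar>u\<bar> \<le> (\<integral>x. F x * tensor (\<lambda>s. 1) (indicator J) x \<partial>square_measure)"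
    unfolding compl[OF Fi Jm bounded_indicator(1)] by simp
  also have "\<dots> = (\<integral>x. F x * indicator ({0<..<1} \<times> J) x \<partial>square_measure)"
    by (intro Bochner_Integration.integral_cong) (auto simp: tensor_def indicator_def unit_square_def)
  finally have "(2 * \<delta> * \<bar>u\<bar>)\<^sup>2 \<le> (\<integral>x. F x * indicator ({0<..<1} \<times> J) x \<partial>square_measure)\<^sup>2"
    using \<delta> by (intro power_mono) auto
  also have "\<dots> \<le> measure square_measure ({0<..<1} \<times> J) * (\<integral>x. (F x)\<^sup>2 \<partial>square_measure)"
  proof (rule square.square_set_integral_le)
    have "F \<in> L2_space unit_square"
      using L2_diff[OF L2_scaled_abs[OF g1(2), of 1] L2_scaled_abs[OF G(2), of "- \<delta>"]]
      by (simp add: F_def[abs_def])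
    then show "F \<in> borel_measurable square_measure" "integrable square_measure (\<lambda>x. (F x)\<^sup>2)"
      by (rule L2_measurable, rule L2_square_integrable)
    show "{0<..<1} \<times> J \<in> sets square_measure"
      using sub by (simp add: sets_restrict_space_iff box)
    show "0 < measure square_measure ({0<..<1} \<times> J)"
      using m \<delta> by simp
  qed
  also note m
  also have "\<delta> * (\<integral>x. (F x)\<^sup>2 \<partial>square_measure) \<le> \<delta> * (\<integral>x. 2 * (g1 x)\<^sup>2 + 2 * \<delta>\<^sup>2 * (G x)\<^sup>2 \<partial>square_measure)"
  proof (intro mult_left_mono integral_mono')
    show "integrable square_measure (\<lambda>x. 2 * (g1 x)\<^sup>2 + 2 * \<delta>\<^sup>2 * (G x)\<^sup>2)"
      by (intro Bochner_Integration.integrable_add integrable_mult_right L2_square_integrable g1 G)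
    show "(F x)\<^sup>2 \<le> 2 * (g1 x)\<^sup>2 + 2 * \<delta>\<^sup>2 * (G x)\<^sup>2" for x
      using zero_le_power2[of "\<bar>g1 x\<bar> - \<delta> * \<bar>G x\<bar>"]
      by (simp add: F_def power2_sum power2_diff power_mult_distrib)
  qed (use \<delta> in auto)
  also have "\<dots> = \<delta> * (2 * (L2_norm unit_square g1)\<^sup>2 + 2 * \<delta>\<^sup>2 * (L2_norm unit_square G)\<^sup>2)"
    using L2_square_integrable[OF g1(2)] L2_square_integrable[OF G(2)] by (simp add: L2_norm_square)
  finally have "4 * \<delta>\<^sup>2 * u\<^sup>2 \<le> 4 * \<delta>\<^sup>2 * (((L2_norm unit_square g1)\<^sup>2 / \<delta> + \<delta> * (L2_norm unit_square G)\<^sup>2) / 2)"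
    using \<delta> by (simp add: power_mult_distrib power2_eq_square algebra_simps)
  then show ?thesis
    using \<delta> by (simp add: u_def)
qed

text \<open>
  The height \<open>\<delta> = 1/(1+\<Gamma>)\<close> is dictated by the coefficient of the gradient term; the coefficient
  \<open>\<delta>/2\<close> of the mixed term is then smaller than required.
\<close>

lemma corner_integral_bound:
  assumes x: "x \<in> {0..1} \<times> {0..1}" and \<Gamma>: "\<Gamma> > 0"
  shows "(corner_integral G x)\<^sup>2 \<le> 1 / 2 * (1 + \<Gamma>) * ((L2_norm unit_square g1)\<^sup>2 + (L2_norm unit_square g2)\<^sup>2)
    + 1 / \<Gamma> * (L2_norm unit_square G)\<^sup>2"
proof -
  have "(corner_integral G x)\<^sup>2 \<le> ((L2_norm unit_square g1)\<^sup>2 / (1 / (1 + \<Gamma>)) + 1 / (1 + \<Gamma>) * (L2_norm unit_square G)\<^sup>2) / 2"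
    using \<Gamma> by (intro corner_integral_strip_bound x) auto
  also have "\<dots> = 1 / 2 * (1 + \<Gamma>) * (L2_norm unit_square g1)\<^sup>2 + 1 / (2 * (1 + \<Gamma>)) * (L2_norm unit_square G)\<^sup>2"
    using \<Gamma> by (simp add: field_simps)
  also have "\<dots> \<le> 1 / 2 * (1 + \<Gamma>) * ((L2_norm unit_square g1)\<^sup>2 + (L2_norm unit_square g2)\<^sup>2) + 1 / \<Gamma> * (L2_norm unit_square G)\<^sup>2"
    using \<Gamma> by (intro add_mono mult_left_mono mult_right_mono) (auto simp: field_simps)
  finally show ?thesis .
qed

end

lemma closure_unit_square: "closure unit_square = {0..1} \<times> {0..1}"
  by (simp add: unit_square_def closure_Times)

lemma C0_norm_square_le:
  assumes "\<Omega> \<noteq> {}" and le: "\<And>x. x \<in> closure \<Omega> \<Longrightarrow> (u x)\<^sup>2 \<le> B"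
  shows "(C0_norm \<Omega> u)\<^sup>2 \<le> B"
proof -
  obtain x where x: "x \<in> closure \<Omega>"
    using assms(1) closure_subset by fastforce
  have B: "0 \<le> B"
    using le[OF x] zero_le_power2[of "u x"] by linarith
  have abs_le: "\<bar>u y\<bar> \<le> sqrt B" if "y \<in> closure \<Omega>" for y
    using real_le_rsqrt[of "\<bar>u y\<bar>" B] le[OF that] by simp
  have "0 \<le> \<bar>u x\<bar>"
    by simp
  also have "\<bar>u x\<bar> \<le> C0_norm \<Omega> u"
    unfolding C0_norm_def by (intro cSUP_upper x bdd_aboveI2[where M = "sqrt B"] abs_le)
  finally have "0 \<le> C0_norm \<Omega> u" .
  moreover have "C0_norm \<Omega> u \<le> sqrt B"
    unfolding C0_norm_def using x by (intro cSUP_least abs_le) auto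
  ultimately show ?thesis
    using power_mono[of "C0_norm \<Omega> u" "sqrt B" 2] B by simp
qed

theorem lemma4:
  fixes w :: "real \<times> real \<Rightarrow> real"
  defines "\<Omega> \<equiv> unit_square"
  assumes "w \<in> sobolev 2 \<Omega> \<inter> sobolev_H10 \<Omega>"
  shows "\<exists>u. continuous_representative \<Omega> w u \<and>
    (\<forall>\<Gamma>>0. (C0_norm \<Omega> u)\<^sup>2
       \<le> 1 / 2 * (1 + \<Gamma>) * ((L2_norm \<Omega> (weak_deriv \<Omega> [e1] w))\<^sup>2 + (L2_norm \<Omega> (weak_deriv \<Omega> [e2] w))\<^sup>2)
         + 1 / \<Gamma> * (L2_norm \<Omega> (weak_deriv \<Omega> [e1, e2] w))\<^sup>2)"
proof -
  have w: "w \<in> sobolev 2 unit_square" "w \<in> sobolev_H10 unit_square"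
    using assms by auto
  interpret H10_mixed w "weak_deriv unit_square [e1] w" "weak_deriv unit_square [e2] w"
    "weak_deriv unit_square [e1, e2] w"
    by unfold_locales (rule w sobolev_weak_deriv[OF w(1)]; simp add: Basis_plane)+
  let ?u = "corner_integral (weak_deriv unit_square [e1, e2] w)"
  have "continuous_on (closure unit_square) ?u"
    by (intro continuous_on_subset[OF continuous_corner_integral] ints) simp
  then have "continuous_representative unit_square w ?u"
    using corner_integral_eq by (simp add: continuous_representative_def)
  moreover have "unit_square \<noteq> {}"
    by (simp add: unit_square_def)
  ultimately show ?thesis
    unfolding \<Omega>_def
    by (intro exI[of _ ?u] conjI allI impI C0_norm_square_le corner_integral_bound)
      (auto simp: closure_unit_square)
qed

end
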